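(* Let $c>0$, $\lambda>0$, let $k\ge 1$ be an integer, and let $\cosh\eta_k(t)$ be the random variable defined in the context from a homogeneous Poisson process $N$ of rate $\lambda$. Then for every $t>0$ $$E\{\cosh \eta_k(t)\, I_{\{N(t)\ge k\}}\}= \frac{1}{2^k} \int_{0}^{t} \cosh c(t-s)\, h(k,c,s)\, g(s;k,\lambda) \, \mathrm{d} s,$$ where $$g(s;k,\lambda)=\frac{e^{-\lambda s} \lambda^k s^{k-1}}{\Gamma(k)},\qquad h(k,c,s)= \sum_{r=0}^{k} \binom{k}{r} E\{e^{cs(2Y_{r,k}-1)} \},$$ with $Y_{r,k}$ a random variable with $\mathrm{Beta}(r,k-r)$ distribution for $1\le r\le k-1$, and with the conventions $Y_{0,k}=1$ and $Y_{k,k}=0$ (so that the terms $r=0$ and $r=k$ contribute $e^{cs}$ and $e^{-cs}$).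
   Context: Let $N(t)$, $t\ge 0$, be a homogeneous Poisson process of rate $\lambda>0$ with successive event times $0<S_1<S_2<\cdots$, and set $S_0=0$. For $t>0$ and on the event $\{N(t)\ge k\}$, $\eta_k(t)\ge 0$ is defined by $$\cosh\eta_k(t)=\cosh c(t-S_k)\prod_{j=1}^{k}\cosh c(S_j-S_{j-1}).$$ It is the hyperbolic distance from the origin at time $t$ of a particle that moves with constant hyperbolic velocity $c$ in the hyperbolic plane, deviates orthogonally at each of the first $k$ Poisson events, and then remains on the same geodesic line until time $t$. $I_A$ denotes the indicator of the event $A$, and $\cosh\eta_k(t)\,I_{\{N(t)\ge k\}}$ is understood as $0$ outside $\{N(t)\ge k\}$. The $\mathrm{Beta}(a,b)$ distribution has density $\frac{\Gamma(a+b)}{\Gamma(a)\Gamma(b)}y^{a-1}(1-y)^{b-1}$ on $(0,1)$. *)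

theory Defs
  imports "HOL-Probability.Probability"
begin

text \<open>
  \<open>S n\<close> is the time of the \<open>n\<close>-th event (\<open>S 0 = 0\<close>) and \<open>N t\<close> the number of events in
  \<open>(0, t]\<close>. The path properties are required almost surely. They make \<open>N\<close> nondecreasing almost
  surely, so the truncated subtraction of natural numbers gives the true increments. The
  finiteness requirement is needed because \<open>card\<close> is \<open>0\<close> on infinite sets.
\<close>
definition poisson_process ::
    "'a measure \<Rightarrow> real \<Rightarrow> (real \<Rightarrow> 'a \<Rightarrow> nat) \<Rightarrow> (nat \<Rightarrow> 'a \<Rightarrow> real) \<Rightarrow> bool" where
  "poisson_process M l N S \<longleftrightarrow>
     prob_space M \<and>
     (\<forall>n. S n \<in> borel_measurable M) \<and>
     (\<forall>t\<ge>0. N t \<in> measurable M (count_space UNIV)) \<and>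
     (AE \<omega> in M. S 0 \<omega> = 0 \<and> strict_mono (\<lambda>n. S n \<omega>) \<and>
        (\<forall>t\<ge>0. finite {n. 1 \<le> n \<and> S n \<omega> \<le> t} \<and> N t \<omega> = card {n. 1 \<le> n \<and> S n \<omega> \<le> t})) \<and>
     (\<forall>n (\<tau> :: nat \<Rightarrow> real). 0 \<le> \<tau> 0 \<and> (\<forall>i<n. \<tau> i \<le> \<tau> (Suc i)) \<longrightarrow>
        prob_space.indep_vars M (\<lambda>_. count_space UNIV)
          (\<lambda>i \<omega>. N (\<tau> (Suc i)) \<omega> - N (\<tau> i) \<omega>) {..<n}) \<and>
     (\<forall>s t. 0 \<le> s \<and> s < t \<longrightarrow>
        distr M (count_space UNIV) (\<lambda>\<omega>. N t \<omega> - N s \<omega>) = measure_pmf (poisson_pmf (l * (t - s))))"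

text \<open>
  The argument of \<open>arcosh\<close> is a product of values of \<open>cosh\<close>, hence at least \<open>1\<close>, so this is the
  unique nonnegative real with the prescribed \<open>cosh\<close>.
\<close>
definition hyp_distance :: "real \<Rightarrow> (nat \<Rightarrow> 'a \<Rightarrow> real) \<Rightarrow> nat \<Rightarrow> real \<Rightarrow> 'a \<Rightarrow> real" where
  "hyp_distance c S k t \<omega> =
     arcosh (cosh (c * (t - S k \<omega>)) * (\<Prod>j=1..k. cosh (c * (S j \<omega> - S (j - 1) \<omega>))))"

definition beta_density :: "real \<Rightarrow> real \<Rightarrow> real \<Rightarrow> real" where
  "beta_density a b y =
     (if 0 < y \<and> y < 1
      then Gamma (a + b) / (Gamma a * Gamma b) * y powr (a - 1) * (1 - y) powr (b - 1) else 0)"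

text \<open>The law of \<open>Y\<^bsub>r,k\<^esub>\<close>, degenerate at \<open>1\<close> for \<open>r = 0\<close> and at \<open>0\<close> for \<open>r = k\<close>.\<close>
definition Y_law :: "nat \<Rightarrow> nat \<Rightarrow> real measure" where
  "Y_law r k =
     (if r = 0 then return borel 1
      else if r = k then return borel 0
      else density lborel (\<lambda>y. ennreal (beta_density (real r) (real k - real r) y)))"

definition g :: "real \<Rightarrow> nat \<Rightarrow> real \<Rightarrow> real" where
  "g s k l = exp (- l * s) * l ^ k * s ^ (k - 1) / Gamma (real k)"

definition h :: "nat \<Rightarrow> real \<Rightarrow> real \<Rightarrow> real" where
  "h k c s = (\<Sum>r=0..k. real (k choose r) * (LINT y|Y_law r k. exp (c * s * (2 * y - 1))))"

end

theory Submission imports Defs begin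

text \<open>
  Almost surely \<open>S j \<le> t\<close> holds exactly when \<open>N t \<ge> j\<close>, so on a cell of a time grid containing
  \<open>S k\<close>, events about \<open>S 0, \<dots>, S k\<close> are events about finitely many earlier counts, and the
  independent increments decouple them from the absence of further events. Refining the grid shows
  that the gap \<open>S (k + 1) - S k\<close> is exponential and independent of \<open>S 0, \<dots>, S k\<close>. Hence the law of
  \<open>S k\<close> weighted by \<open>\<Prod>j\<le>k. cosh (c (S j - S (j - 1)))\<close> is the \<open>k\<close>-fold convolution power of
  \<open>l exp (- l x) cosh (c x) = (l / 2) (exp ((c - l) x) + exp ((- c - l) x))\<close>. Expanding it
  binomially gives convolutions of \<open>x\<^sup>r\<^sup>-\<^sup>1 exp ((c - l) x)\<close> and \<open>x\<^sup>k\<^sup>-\<^sup>r\<^sup>-\<^sup>1 exp ((- c - l) x)\<close>, which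
  the substitution \<open>x = s y\<close> turns into exponential moments of Beta laws.
\<close>

section \<open>Convolutions of exponential polynomials\<close>

text \<open>Densities on the half line are encoded as functions vanishing on negative arguments, so
  integrating over the whole line gives the usual convolution over \<open>{0..s}\<close>. Values in
  \<open>ennreal\<close> allow Tonelli without integrability conditions.\<close>

definition conv :: "(real \<Rightarrow> ennreal) \<Rightarrow> (real \<Rightarrow> ennreal) \<Rightarrow> real \<Rightarrow> ennreal" where
  "conv p q s = (\<integral>\<^sup>+x. p x * q (s - x) \<partial>lborel)"

lemma borel_measurable_conv [measurable]:
  assumes [measurable]: "p \<in> borel_measurable borel" "q \<in> borel_measurable borel"
  shows "conv p q \<in> borel_measurable borel"
  unfolding conv_def by measurable

lemma conv_commute:
  assumes [measurable]: "p \<in> borel_measurable borel" "q \<in> borel_measurable borel"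
  shows "conv p q = conv q p"
proof
  fix s
  have "conv p q s = ennreal \<bar>-1\<bar> * (\<integral>\<^sup>+x. p (s + (-1) * x) * q (s - (s + (-1) * x)) \<partial>lborel)"
    unfolding conv_def by (rule nn_integral_real_affine) auto
  also have "\<dots> = conv q p s"
    by (simp add: conv_def mult.commute)
  finally show "conv p q s = conv q p s" .
qed

text \<open>Tonelli exchanges the two integrals, and translation by \<open>y\<close> turns the inner
  one into a convolution evaluated at \<open>s - y\<close>.\<close>

lemma conv_assoc:
  assumes [measurable]: "p \<in> borel_measurable borel" "q \<in> borel_measurable borel"
    "r \<in> borel_measurable borel"
  shows "conv (conv p q) r = conv p (conv q r)"
proof
  fix s
  have "conv (conv p q) r s = (\<integral>\<^sup>+x. \<integral>\<^sup>+y. p y * q (x - y) * r (s - x) \<partial>lborel \<partial>lborel)"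
    unfolding conv_def by (subst nn_integral_multc[symmetric]) auto
  also have "\<dots> = (\<integral>\<^sup>+y. \<integral>\<^sup>+x. p y * q (x - y) * r (s - x) \<partial>lborel \<partial>lborel)"
    by (rule lborel_pair.Fubini') measurable
  also have "\<dots> = (\<integral>\<^sup>+y. p y * (\<integral>\<^sup>+x. q (x - y) * r (s - x) \<partial>lborel) \<partial>lborel)"
    by (subst nn_integral_cmult[symmetric]) (auto simp: mult.assoc)
  also have "\<dots> = (\<integral>\<^sup>+y. p y * (\<integral>\<^sup>+x. q x * r (s - y - x) \<partial>lborel) \<partial>lborel)"
  proof -
    have "(\<integral>\<^sup>+x. q (x - y) * r (s - x) \<partial>lborel) =
        ennreal \<bar>1\<bar> * (\<integral>\<^sup>+x. q ((y + 1 * x) - y) * r (s - (y + 1 * x)) \<partial>lborel)" for y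
      by (rule nn_integral_real_affine) auto
    then show ?thesis by (simp add: algebra_simps)
  qed
  finally show "conv (conv p q) r s = conv p (conv q r) s"
    by (simp add: conv_def)
qed

lemma conv_add_left:
  assumes [measurable]: "p \<in> borel_measurable borel" "q \<in> borel_measurable borel"
    "r \<in> borel_measurable borel"
  shows "conv (\<lambda>x. p x + q x) r s = conv p r s + conv q r s"
  unfolding conv_def by (subst nn_integral_add[symmetric]) (auto simp: distrib_right)

lemma conv_sum_right:
  assumes [measurable]: "p \<in> borel_measurable borel" "\<And>i. q i \<in> borel_measurable borel"
  shows "conv p (\<lambda>x. \<Sum>i\<in>A. a i * q i x) s = (\<Sum>i\<in>A. a i * conv p (q i) s)"
proof -
  have "conv p (\<lambda>x. \<Sum>i\<in>A. a i * q i x) s = (\<integral>\<^sup>+x. (\<Sum>i\<in>A. a i * (p x * q i (s - x))) \<partial>lborel)"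
    unfolding conv_def by (simp add: sum_distrib_left mult_ac)
  also have "\<dots> = (\<Sum>i\<in>A. a i * conv p (q i) s)"
    unfolding conv_def by (subst nn_integral_sum) (auto simp: nn_integral_cmult)
  finally show ?thesis .
qed

text \<open>This is the convolution power of order \<open>n + 1\<close> of
  \<open>exp (\<theta> * x)\<close> on the half line. It is not normalised to a probability density
  because \<theta> may have either sign: it will be \<open>c - l\<close> or
  \<open>- c - l\<close>.\<close>

definition gam :: "nat \<Rightarrow> real \<Rightarrow> real \<Rightarrow> ennreal" where
  "gam n \<theta> x = ennreal (if x < 0 then 0 else x ^ n * exp (\<theta> * x) / fact n)"

lemma gam_nonneg_arg: "x \<ge> 0 \<Longrightarrow> gam n \<theta> x = ennreal (x ^ n * exp (\<theta> * x) / fact n)"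
  by (simp add: gam_def)

lemma borel_measurable_gam [measurable]: "gam n \<theta> \<in> borel_measurable borel"
  unfolding gam_def by measurable

text \<open>With equal rates the exponentials multiply to \<open>exp (\<theta> * s)\<close>, which
  is constant in the integration variable, so only \<open>x ^ n / fact n\<close> is integrated over
  \<open>{0..s}\<close>.\<close>

lemma conv_gam_gam_0: "conv (gam n \<theta>) (gam 0 \<theta>) = gam (Suc n) \<theta>"
proof
  fix s
  show "conv (gam n \<theta>) (gam 0 \<theta>) s = gam (Suc n) \<theta> s"
  proof (cases "s < 0")
    case True
    then have "gam n \<theta> x * gam 0 \<theta> (s - x) = 0" for x
      by (simp add: gam_def)
    then have "conv (gam n \<theta>) (gam 0 \<theta>) s = 0"
      by (simp only: conv_def nn_integral_const mult_zero_left)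
    with True show ?thesis by (simp add: gam_def)
  next
    case False
    have "gam n \<theta> x * gam 0 \<theta> (s - x) = ennreal (x ^ n / fact n * exp (\<theta> * s)) * indicator {0..s} x"
      for x
      using False
      by (auto simp: gam_def indicator_def ennreal_mult[symmetric] exp_add[symmetric] algebra_simps)
    then have "conv (gam n \<theta>) (gam 0 \<theta>) s =
        (\<integral>\<^sup>+x. ennreal (x ^ n / fact n * exp (\<theta> * s)) * indicator {0..s} x \<partial>lborel)"
      by (simp add: conv_def)
    also have "\<dots> = ennreal (s ^ Suc n / fact (Suc n) * exp (\<theta> * s) - 0 ^ Suc n / fact (Suc n) * exp (\<theta> * s))"
    proof (rule nn_integral_FTC_Icc)
      fix x :: real assume "x \<in> {0..s}"
      have "((\<lambda>x. x ^ Suc n / fact (Suc n) * exp (\<theta> * s)) has_real_derivative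
          real (Suc n) * x ^ n / fact (Suc n) * exp (\<theta> * s)) (at x)"
        by (intro DERIV_cmult_right DERIV_cdivide) (use DERIV_pow[of "Suc n" x UNIV] in simp)
      also have "real (Suc n) * x ^ n / fact (Suc n) = x ^ n / fact n"
        by (simp del: of_nat_Suc)
      finally show "((\<lambda>x. x ^ Suc n / fact (Suc n) * exp (\<theta> * s)) has_real_derivative
          x ^ n / fact n * exp (\<theta> * s)) (at x)" .
    qed (use False in auto)
    also have "\<dots> = gam (Suc n) \<theta> s"
      using False by (simp add: gam_def)
    finally show ?thesis .
  qed
qed

text \<open>
  The convolution of \<open>a\<close> copies of \<open>exp (\<alpha> x)\<close> and \<open>b\<close> copies of \<open>exp (\<beta> x)\<close> on \<open>x \<ge> 0\<close>. The value
  for \<open>a = b = 0\<close>, which should be a point mass at \<open>0\<close>, is junk.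
\<close>
definition two_rate :: "real \<Rightarrow> real \<Rightarrow> nat \<Rightarrow> nat \<Rightarrow> real \<Rightarrow> ennreal" where
  "two_rate \<alpha> \<beta> a b =
     (if b = 0 then gam (a - 1) \<alpha> else if a = 0 then gam (b - 1) \<beta>
      else conv (gam (a - 1) \<alpha>) (gam (b - 1) \<beta>))"

lemma borel_measurable_two_rate [measurable]: "two_rate \<alpha> \<beta> a b \<in> borel_measurable borel"
  unfolding two_rate_def by auto

text \<open>The assumption excludes \<open>a = b = 0\<close>, whose junk value does not act as the
  unit of convolution.\<close>

lemma conv_gam_two_rate_left:
  assumes "a + b \<ge> 1"
  shows "conv (gam 0 \<alpha>) (two_rate \<alpha> \<beta> a b) = two_rate \<alpha> \<beta> (Suc a) b"
proof -
  have *: "conv (gam 0 \<alpha>) (gam (a - 1) \<alpha>) = gam a \<alpha>" if "a > 0"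
    using that by (subst conv_commute) (auto simp: conv_gam_gam_0)
  show ?thesis
    using assms * by (auto simp: two_rate_def conv_assoc[symmetric])
qed

lemma conv_gam_two_rate_right:
  assumes "a + b \<ge> 1"
  shows "conv (gam 0 \<beta>) (two_rate \<alpha> \<beta> a b) = two_rate \<alpha> \<beta> a (Suc b)"
proof -
  have "conv (gam 0 \<beta>) (two_rate \<alpha> \<beta> a b) = conv (two_rate \<alpha> \<beta> a b) (gam 0 \<beta>)"
    by (rule conv_commute) auto
  then show ?thesis
    using assms by (auto simp: two_rate_def conv_assoc conv_gam_gam_0)
qed

text \<open>For \<open>k \<ge> 1\<close> this is the binomial expansion of the \<open>k\<close>-fold
  convolution power of \<open>exp (\<alpha> * x) + exp (\<beta> * x)\<close> on the half
  line.\<close>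

definition rate_mix :: "real \<Rightarrow> real \<Rightarrow> nat \<Rightarrow> real \<Rightarrow> ennreal" where
  "rate_mix \<alpha> \<beta> k s = (\<Sum>r\<le>k. of_nat (k choose r) * two_rate \<alpha> \<beta> r (k - r) s)"

lemma borel_measurable_rate_mix [measurable]: "rate_mix \<alpha> \<beta> k \<in> borel_measurable borel"
  unfolding rate_mix_def by measurable

lemma rate_mix_1: "rate_mix \<alpha> \<beta> 1 s = gam 0 \<alpha> s + gam 0 \<beta> s"
  by (simp add: rate_mix_def two_rate_def)

text \<open>Pascal's rule for a family indexed by two exponents: one further factor raises either
  the first exponent or the second.\<close>

lemma sum_choose_Suc:
  fixes w :: "nat \<Rightarrow> nat \<Rightarrow> 'a::comm_semiring_1"
  shows "(\<Sum>r\<le>Suc k. of_nat (Suc k choose r) * w r (Suc k - r)) =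
    (\<Sum>r\<le>k. of_nat (k choose r) * w (Suc r) (k - r)) + (\<Sum>r\<le>k. of_nat (k choose r) * w r (Suc (k - r)))"
proof -
  have "(\<Sum>r\<le>Suc k. of_nat (Suc k choose r) * w r (Suc k - r)) =
      w 0 (Suc k) + (\<Sum>r\<le>k. of_nat (Suc k choose Suc r) * w (Suc r) (k - r))"
    by (subst sum.atMost_Suc_shift) simp
  also have "\<dots> = (\<Sum>r\<le>k. of_nat (k choose r) * w (Suc r) (k - r)) +
      (w 0 (Suc k) + (\<Sum>r\<le>k. of_nat (k choose Suc r) * w (Suc r) (k - r)))"
    by (simp add: distrib_right distrib_left sum.distrib ac_simps)
  also have "w 0 (Suc k) + (\<Sum>r\<le>k. of_nat (k choose Suc r) * w (Suc r) (k - r)) =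
      (\<Sum>r\<le>Suc k. of_nat (k choose r) * w r (Suc k - r))"
    unfolding sum.atMost_Suc_shift[of "\<lambda>r. of_nat (k choose r) * w r (Suc k - r)"] by simp
  \<comment> \<open>The top term \<open>r = Suc k\<close> drops out because
    \<open>k choose Suc k\<close> is zero.\<close>
  also have "\<dots> = (\<Sum>r\<le>k. of_nat (k choose r) * w r (Suc (k - r)))"
    by (simp add: binomial_eq_0 Suc_diff_le)
  finally show ?thesis .
qed

text \<open>Induction step of the binomial expansion. Since \<open>k \<ge> 1\<close>, no summand
  \<open>two_rate \<alpha> \<beta> r (k - r)\<close> is the junk case.\<close>

lemma conv_rate_mix:
  assumes "k \<ge> 1"
  shows "conv (\<lambda>x. gam 0 \<alpha> x + gam 0 \<beta> x) (rate_mix \<alpha> \<beta> k) s = rate_mix \<alpha> \<beta> (Suc k) s"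
proof -
  have "conv (gam 0 \<theta>) (rate_mix \<alpha> \<beta> k) s =
      (\<Sum>r\<le>k. of_nat (k choose r) * conv (gam 0 \<theta>) (two_rate \<alpha> \<beta> r (k - r)) s)" for \<theta>
    unfolding rate_mix_def[abs_def] by (rule conv_sum_right) auto
  moreover have "r + (k - r) \<ge> 1" if "r \<le> k" for r
    using that assms by simp
  ultimately show ?thesis
    by (simp add: conv_add_left conv_gam_two_rate_left conv_gam_two_rate_right rate_mix_def[of _ _ "Suc k"]
        del: sum.atMost_Suc, subst sum_choose_Suc[where w="\<lambda>a b. two_rate \<alpha> \<beta> a b s"], simp)
qed

section \<open>Exponential moments of Beta laws\<close>

text \<open>Scaling by \<open>x = s * y\<close> moves the convolution to the unit interval. The
  powers of \<open>s\<close> add up to \<open>(a - 1) + (b - 1) + 1\<close>, and the two factorials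
  are the Beta normalisation up to \<open>fact (a + b - 1)\<close>.\<close>

lemma two_rate_closed_form:
  assumes "a > 0" "b > 0" "s > 0"
  shows "two_rate \<alpha> \<beta> a b s = (\<integral>\<^sup>+y. ennreal (s ^ (a + b - 1) / fact (a + b - 1) *
    (beta_density (real a) (real b) y * exp (s * (\<alpha> * y + \<beta> * (1 - y))))) \<partial>lborel)"
proof -
  obtain m n where mn: "a = Suc m" "b = Suc n"
    using assms by (metis Suc_pred)
  have "two_rate \<alpha> \<beta> a b s = conv (gam m \<alpha>) (gam n \<beta>) s"
    by (simp add: two_rate_def mn)
  also have "\<dots> = ennreal \<bar>s\<bar> * (\<integral>\<^sup>+y. gam m \<alpha> (0 + s * y) * gam n \<beta> (s - (0 + s * y)) \<partial>lborel)"
    unfolding conv_def by (rule nn_integral_real_affine) (use assms in auto)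
  also have "\<dots> = (\<integral>\<^sup>+y. ennreal s * (gam m \<alpha> (s * y) * gam n \<beta> (s - s * y)) \<partial>lborel)"
    using assms by (subst nn_integral_cmult) auto
  also have "\<dots> = (\<integral>\<^sup>+y. ennreal (s ^ (a + b - 1) / fact (a + b - 1) *
    (beta_density (real a) (real b) y * exp (s * (\<alpha> * y + \<beta> * (1 - y))))) \<partial>lborel)"
  proof (rule nn_integral_cong_AE)
    \<comment> \<open>The endpoints must be discarded: \<open>beta_density\<close> is zero there by
      definition, whereas \<open>gam 0\<close> equals one at zero.\<close>
    have "AE y in lborel. y \<noteq> (0::real) \<and> y \<noteq> 1"
      using AE_lborel_singleton[of "0::real"] AE_lborel_singleton[of "1::real"] by eventually_elim auto
    then show "AE y in lborel. ennreal s * (gam m \<alpha> (s * y) * gam n \<beta> (s - s * y)) =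
      ennreal (s ^ (a + b - 1) / fact (a + b - 1) *
    (beta_density (real a) (real b) y * exp (s * (\<alpha> * y + \<beta> * (1 - y)))))"
    proof eventually_elim
      case (elim y)
      show ?case
      proof (cases "0 < y \<and> y < 1")
        case True
        have G: "Gamma (real a) = fact m" "Gamma (real b) = fact n" "Gamma (real a + real b) = fact (a + b - 1)"
          using Gamma_fact[of m, where 'a=real] Gamma_fact[of n, where 'a=real]
            Gamma_fact[of "m + n + 1", where 'a=real]
          by (simp_all add: mn add_ac)
        have B: "beta_density (real a) (real b) y = fact (a + b - 1) / (fact m * fact n) * y ^ m * (1 - y) ^ n"
          unfolding beta_density_def G using True by (simp add: mn powr_realpow)
        have e: "exp (s * (\<alpha> * y + \<beta> * (1 - y))) = exp (\<alpha> * (s * y)) * exp (\<beta> * (s * (1 - y)))"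
          by (simp add: exp_add[symmetric] algebra_simps)
        have "s - s * y = s * (1 - y)" by (simp add: algebra_simps)
        moreover have "s * (1 - y) > 0" "s * y > 0" using True assms by auto
        ultimately have "ennreal s * (gam m \<alpha> (s * y) * gam n \<beta> (s - s * y)) =
          ennreal (s * ((s * y) ^ m * exp (\<alpha> * (s * y)) / fact m * ((s * (1 - y)) ^ n * exp (\<beta> * (s * (1 - y))) / fact n)))"
          using assms by (simp add: gam_nonneg_arg ennreal_mult[symmetric] less_imp_le)
        also have "s * ((s * y) ^ m * exp (\<alpha> * (s * y)) / fact m * ((s * (1 - y)) ^ n * exp (\<beta> * (s * (1 - y))) / fact n))
          = s ^ (a + b - 1) / fact (a + b - 1) *
            (beta_density (real a) (real b) y * exp (s * (\<alpha> * y + \<beta> * (1 - y))))"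
          unfolding B e by (simp add: mn power_add power_mult_distrib del: fact_Suc)
        finally show ?thesis .
      next
        case False
        with elim have "y < 0 \<or> y > 1" by auto
        then have "s * y < 0 \<or> s - s * y < 0" using assms by (auto simp: mult_less_0_iff)
        then show ?thesis using False by (auto simp: gam_def beta_density_def)
      qed
    qed
  qed
  finally show ?thesis .
qed

lemma beta_density_nonneg:
  assumes "a > 0" "b > 0"
  shows "beta_density a b y \<ge> 0"
  using assms by (auto simp: beta_density_def)

lemma borel_measurable_beta_density [measurable]: "beta_density a b \<in> borel_measurable borel"
  unfolding beta_density_def[abs_def] by measurable

text \<open>With both parameters at least one the powers are bounded by one, so a constant on the
  unit interval dominates. Integer parameters strictly between \<open>0\<close> and \<open>k\<close>
  fall under this case.\<close>

lemma integrable_beta_density_exp: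
  assumes "a \<ge> 1" "b \<ge> 1"
  shows "integrable lborel (\<lambda>y. beta_density a b y * exp (x * (2 * y - 1)))"
proof (rule Bochner_Integration.integrable_bound)
  let ?C = "Gamma (a + b) / (Gamma a * Gamma b) * exp \<bar>x\<bar>"
  show "integrable lborel (\<lambda>y. ?C * indicator {0..1::real} y :: real)"
    by (intro integrable_mult_right integrable_real_indicator) auto
  show "AE y in lborel. norm (beta_density a b y * exp (x * (2 * y - 1))) \<le> norm (?C * indicator {0..1::real} y :: real)"
  proof (intro AE_I2)
    fix y
    show "norm (beta_density a b y * exp (x * (2 * y - 1))) \<le> norm (?C * indicator {0..1::real} y :: real)"
    proof (cases "0 < y \<and> y < 1")
      case True
      have "x * (2 * y - 1) \<le> \<bar>x\<bar> * \<bar>2 * y - 1\<bar>" by (metis abs_ge_self abs_mult)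
      also have "\<dots> \<le> \<bar>x\<bar> * 1" using True by (intro mult_left_mono) auto
      finally have 1: "exp (x * (2 * y - 1)) \<le> exp \<bar>x\<bar>" by simp
      have p: "y powr (a - 1) \<le> 1" "(1 - y) powr (b - 1) \<le> 1"
        using True assms by (auto intro!: powr_le1)
      then have "y powr (a - 1) * (1 - y) powr (b - 1) \<le> 1"
        by (intro mult_le_one) auto
      then have "Gamma (a + b) / (Gamma a * Gamma b) * (y powr (a - 1) * (1 - y) powr (b - 1)) * exp (x * (2 * y - 1))
          \<le> Gamma (a + b) / (Gamma a * Gamma b) * 1 * exp \<bar>x\<bar>"
        using 1 assms by (intro mult_mono) auto
      then show ?thesis using True assms
        by (simp add: beta_density_def abs_mult mult_ac)
    next
      case False
      then show ?thesis by (auto simp: beta_density_def)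
    qed
  qed
qed auto

lemma integral_Y_law:
  assumes "0 < r" "r < k"
  shows "(LINT y|Y_law r k. exp (x * (2 * y - 1))) =
    (LINT y|lborel. beta_density (real r) (real k - real r) y * exp (x * (2 * y - 1)))"
  using assms by (simp add: Y_law_def integral_density beta_density_nonneg)

lemma integral_Y_law_nonneg: "(LINT y|Y_law r k. exp (x * (2 * y - 1))) \<ge> 0"
  by (rule integral_nonneg_AE) auto

lemma two_rate_eq_integral_Y_law:
  assumes "0 < r" "r < k" "s > 0"
  shows "two_rate (c - l) (- c - l) r (k - r) s =
    ennreal (exp (- l * s) * s ^ (k - 1) / fact (k - 1) * (LINT y|Y_law r k. exp (c * s * (2 * y - 1))))"
proof -
  let ?K = "exp (- l * s) * s ^ (k - 1) / fact (k - 1)"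
  let ?d = "\<lambda>y. beta_density (real r) (real k - real r) y * exp (c * s * (2 * y - 1))"
  have "two_rate (c - l) (- c - l) r (k - r) s = (\<integral>\<^sup>+y. ennreal (?K * ?d y) \<partial>lborel)"
  proof (subst two_rate_closed_form)
    have "s ^ (k - 1) / fact (k - 1) * (beta_density (real r) (real k - real r) y *
        exp (s * ((c - l) * y + (- c - l) * (1 - y)))) = ?K * ?d y" for y
    proof -
      \<comment> \<open>The rate \<open>- l\<close> is common to both exponentials and factors out;
        the remaining \<open>c * y - c * (1 - y)\<close> is \<open>c * (2 * y - 1)\<close>.\<close>
      have "exp (s * ((c - l) * y + (- c - l) * (1 - y))) = exp (- l * s) * exp (c * s * (2 * y - 1))"
        by (simp add: exp_add[symmetric] algebra_simps)
      then show ?thesis by simp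
    qed
    then show "(\<integral>\<^sup>+y. ennreal (s ^ (r + (k - r) - 1) / fact (r + (k - r) - 1) *
        (beta_density (real r) (real (k - r)) y * exp (s * ((c - l) * y + (- c - l) * (1 - y))))) \<partial>lborel) =
        (\<integral>\<^sup>+y. ennreal (?K * ?d y) \<partial>lborel)"
      using assms by (simp only: of_nat_diff less_imp_le le_add_diff_inverse)
  qed (use assms in auto)
  also have "\<dots> = ennreal (LINT y|lborel. ?K * ?d y)"
    using assms
    by (intro nn_integral_eq_integral integrable_mult_right integrable_beta_density_exp AE_I2
        mult_nonneg_nonneg beta_density_nonneg) auto
  finally show ?thesis
    using assms by (simp only: integral_mult_right_zero integral_Y_law)
qed

text \<open>Interior summands are Beta moments and the two ends are pure exponentials; all share one
  factor independent of \<open>r\<close>, so the sum is that factor times \<open>h\<close>.\<close>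

lemma rate_mix_eq:
  assumes "k \<ge> 1" "s > 0"
  shows "rate_mix (c - l) (- c - l) k s = ennreal (h k c s * exp (- l * s) * s ^ (k - 1) / fact (k - 1))"
proof -
  let ?K = "exp (- l * s) * s ^ (k - 1) / fact (k - 1)"
  let ?E = "\<lambda>r. LINT y|Y_law r k. exp (c * s * (2 * y - 1))"
  let ?w = "\<lambda>r. two_rate (c - l) (- c - l) r (k - r) s"
  \<comment> \<open>The degenerate laws sit at the opposite ends (\<open>r\<close> is the first Beta parameter, yet \<open>Y\<^bsub>0,k\<^esub> = 1\<close>);
    this is harmless as both ends have binomial coefficient \<open>1\<close>.\<close>
  have E: "?w 0 = ennreal (?K * ?E k)" "?w k = ennreal (?K * ?E 0)"
    using assms by (simp_all add: two_rate_def gam_def Y_law_def integral_return exp_add[symmetric] algebra_simps)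
  have split: "(\<Sum>r\<le>k. F r) = F 0 + (\<Sum>r\<in>{1..<k}. F r) + F k" for F :: "nat \<Rightarrow> 'b::comm_monoid_add"
  proof -
    have "{..k} = insert 0 (insert k {1..<k})" using assms by auto
    then show ?thesis using assms by (simp add: ac_simps)
  qed
  have "rate_mix (c - l) (- c - l) k s = (\<Sum>r\<le>k. ennreal (real (k choose r) * (?K * ?E r)))"
  proof -
    have "(\<Sum>r\<in>{1..<k}. of_nat (k choose r) * ?w r) = (\<Sum>r\<in>{1..<k}. ennreal (real (k choose r) * (?K * ?E r)))"
    proof (intro sum.cong refl)
      fix r assume "r \<in> {1..<k}"
      then have "?w r = ennreal (?K * ?E r)"
        using assms by (intro two_rate_eq_integral_Y_law) auto
      then show "of_nat (k choose r) * ?w r = ennreal (real (k choose r) * (?K * ?E r))"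
        by (simp only: ennreal_mult' of_nat_0_le_iff ennreal_of_nat_eq_real_of_nat)
    qed
    then show ?thesis
      unfolding rate_mix_def split E by (simp add: add_ac)
  qed
  also have "\<dots> = ennreal (\<Sum>r\<le>k. real (k choose r) * (?K * ?E r))"
    using assms by (intro sum_ennreal mult_nonneg_nonneg integral_Y_law_nonneg) auto
  also have "(\<Sum>r\<le>k. real (k choose r) * (?K * ?E r)) = h k c s * exp (- l * s) * s ^ (k - 1) / fact (k - 1)"
    by (simp add: h_def sum_distrib_left sum_distrib_right atLeast0AtMost mult_ac sum_divide_distrib)
  finally show ?thesis .
qed

lemma borel_measurable_h [measurable]: "h k c \<in> borel_measurable borel"
proof -
  have "(\<lambda>s. LINT y|Y_law r k. exp (c * s * (2 * y - 1))) \<in> borel_measurable borel" if "r \<le> k" for r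
  proof (cases "r = 0 \<or> r = k")
    case True
    then show ?thesis by (auto simp: Y_law_def integral_return)
  next
    case False
    with that have "0 < r" "r < k" by auto
    then show ?thesis
      by (simp add: integral_Y_law)
  qed
  then show ?thesis
    unfolding h_def[abs_def] by (intro borel_measurable_sum borel_measurable_times) auto
qed

lemma h_nonneg: "h k c s \<ge> 0"
  unfolding h_def by (intro sum_nonneg mult_nonneg_nonneg integral_Y_law_nonneg) auto

lemma borel_measurable_cosh_real [measurable]: "cosh \<in> borel_measurable (borel :: real measure)"
  by (intro borel_measurable_continuous_onI continuous_intros)

lemma cosh_le_exp: "cosh x \<le> exp x" if "x \<ge> 0" for x :: real
proof -
  have "exp (- x) \<le> exp x" using that by simp
  then show ?thesis by (simp add: cosh_def)
qed

section \<open>Arrival times\<close>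

lemma pair_vimage:
  "(p -` X \<inter> A) \<inter> (q -` Y \<inter> A) = (\<lambda>x. (p x, q x)) -` (X \<times> Y) \<inter> A"
  by auto

text \<open>Rounding up to a grid of mesh \<open>1 / Suc n\<close> has half-open cells, closed on
  the right, and the cell of index zero is the single point zero. The disjunct \<open>i = 0\<close>
  is there because truncated \<open>i - 1\<close> would otherwise demand
  \<open>0 < x\<close>.\<close>

lemma nat_ceiling_eq_iff:
  assumes "x \<ge> 0"
  shows "nat \<lceil>x * real (Suc n)\<rceil> = i \<longleftrightarrow>
    (i = 0 \<or> real (i - 1) / real (Suc n) < x) \<and> x \<le> real i / real (Suc n)"
proof -
  have "real (i - 1) / real (Suc n) < x \<longleftrightarrow> real (i - 1) < x * real (Suc n)"
    by (rule pos_divide_less_eq) simp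
  moreover have "x \<le> real i / real (Suc n) \<longleftrightarrow> x * real (Suc n) \<le> real i"
    by (rule pos_le_divide_eq) simp
  moreover have "0 \<le> x * real (Suc n)"
    using assms by simp
  ultimately show ?thesis
    by (cases i) (auto simp del: of_nat_Suc, linarith+)
qed

locale poisson_arrivals =
  fixes M :: "'a measure" and l :: real and N :: "real \<Rightarrow> 'a \<Rightarrow> nat" and S :: "nat \<Rightarrow> 'a \<Rightarrow> real"
  assumes rate_pos: "l > 0"
    and process: "poisson_process M l N S"
begin

sublocale prob_space M
  using process by (simp add: poisson_process_def)

lemma arrival_measurable [measurable]: "S n \<in> borel_measurable M"
  using process by (simp add: poisson_process_def)

lemma count_measurable: "t \<ge> 0 \<Longrightarrow> N t \<in> measurable M (count_space UNIV)"
  using process by (simp add: poisson_process_def)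

text \<open>The equivalence of \<open>j \<le> N t \<omega>\<close> and
  \<open>S j \<omega> \<le> t\<close> is the dictionary between counts and arrival times. By
  monotonicity the arrivals up to \<open>t\<close> have an initial segment of indices, so their
  cardinality determines which have occurred.\<close>

lemma AE_path:
  "AE \<omega> in M. S 0 \<omega> = 0 \<and> (\<forall>i j. S i \<omega> \<le> S j \<omega> \<longleftrightarrow> i \<le> j) \<and> (\<forall>t\<ge>0. \<forall>j. j \<le> N t \<omega> \<longleftrightarrow> S j \<omega> \<le> t)"
proof -
  have "AE \<omega> in M. S 0 \<omega> = 0 \<and> strict_mono (\<lambda>n. S n \<omega>) \<and>
      (\<forall>t\<ge>0. finite {n. 1 \<le> n \<and> S n \<omega> \<le> t} \<and> N t \<omega> = card {n. 1 \<le> n \<and> S n \<omega> \<le> t})"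
    using process by (simp add: poisson_process_def)
  then show ?thesis
  proof eventually_elim
    case (elim \<omega>)
    have le_iff: "S i \<omega> \<le> S j \<omega> \<longleftrightarrow> i \<le> j" for i j
      using elim strict_mono_less_eq[of "\<lambda>n. S n \<omega>" i j] by simp
    have "j \<le> N t \<omega> \<longleftrightarrow> S j \<omega> \<le> t" if t: "t \<ge> 0" for t j
    proof -
      let ?A = "{n. 1 \<le> n \<and> S n \<omega> \<le> t}"
      have fin: "finite ?A" and card: "N t \<omega> = card ?A"
        using elim[THEN conjunct2, THEN conjunct2, rule_format, OF t] by simp_all
      show ?thesis
      proof
        assume "S j \<omega> \<le> t"
        then have "S i \<omega> \<le> t" if "i \<le> j" for i
          using le_iff[of i j] that by simp
        then have "{1..j} \<subseteq> ?A"
          by auto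
        from card_mono[OF fin this] show "j \<le> N t \<omega>"
          by (simp add: card)
      next
        assume j: "j \<le> N t \<omega>"
        show "S j \<omega> \<le> t"
        proof (rule ccontr)
          assume "\<not> S j \<omega> \<le> t"
          moreover have "S j \<omega> \<le> S i \<omega>" if "i \<ge> j" for i
            using le_iff that by blast
          ultimately have "?A \<subseteq> {1..<j}"
            by (smt (verit) atLeastLessThan_iff mem_Collect_eq not_le subsetI)
          from card_mono[OF _ this] have "N t \<omega> \<le> j - 1"
            by (simp add: card)
          \<comment> \<open>For \<open>j = 0\<close> the bound \<open>j - 1\<close> would truncate
            to zero and contradict nothing; that case is impossible since
            \<open>S 0 \<omega> = 0 \<le> t\<close>.\<close>
          moreover have "j > 0"
            using \<open>\<not> S j \<omega> \<le> t\<close> elim t by (cases j) auto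
          ultimately show False
            using j by simp
        qed
      qed
    qed
    then show ?case using elim le_iff by blast
  qed
qed

section \<open>Decoupling past arrivals from the absence of further events\<close>

lemma prob_no_event:
  assumes "0 \<le> s" "0 \<le> u"
  shows "prob {\<omega> \<in> space M. N (s + u) \<omega> - N s \<omega> = 0} = exp (- l * u)"
proof (cases "u = 0")
  \<comment> \<open>The process prescribes increment laws only for strictly increasing times, so the
    empty interval is treated apart.\<close>
  case True
  then show ?thesis by (simp add: prob_space)
next
  case False
  have [measurable]: "N (s + u) \<in> measurable M (count_space UNIV)" "N s \<in> measurable M (count_space UNIV)"
    using assms by (auto intro: count_measurable)
  have "s < s + u" using False assms by simp
  then have D: "distr M (count_space UNIV) (\<lambda>\<omega>. N (s + u) \<omega> - N s \<omega>) = measure_pmf (poisson_pmf (l * (s + u - s)))"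
    using process assms unfolding poisson_process_def by blast
  have "prob {\<omega> \<in> space M. N (s + u) \<omega> - N s \<omega> = 0} =
      measure (distr M (count_space UNIV) (\<lambda>\<omega>. N (s + u) \<omega> - N s \<omega>)) {0}"
    by (subst measure_distr) (auto intro!: arg_cong[where f=prob])
  also have "\<dots> = pmf (poisson_pmf (l * u)) 0"
    unfolding D by (simp add: measure_pmf_single)
  also have "\<dots> = exp (- l * u)"
    using assms rate_pos False by (subst pmf_poisson) auto
  finally show ?thesis .
qed

text \<open>The Markov property for finitely many observations. Counts at times up to \<tau> are
  sums of increments over intervals ending by \<tau>, and these are independent of the increment
  after \<tau>. The use of \<open>restrict\<close> confines \<open>Q\<close> to the counts at times
  in \<open>A\<close>.\<close>

lemma prob_past_no_event:
  assumes A: "finite A" "A \<subseteq> {0..\<tau>}" and \<tau>: "0 \<le> \<tau>" and u: "0 \<le> u"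
  shows "prob {\<omega> \<in> space M. Q (restrict (\<lambda>a. N a \<omega>) A) \<and> N (\<tau> + u) \<omega> - N \<tau> \<omega> = 0} =
    prob {\<omega> \<in> space M. Q (restrict (\<lambda>a. N a \<omega>) A)} * exp (- l * u)"
proof -
  \<comment> \<open>Inserting \<open>0\<close> anchors the partial sums at a count that is almost
    surely zero; inserting \<tau> makes the last interval start exactly at \<tau>.\<close>
  define xs where "xs = sorted_list_of_set (insert 0 (insert \<tau> A))"
  define n where "n = length xs - 1"
  \<comment> \<open>The grid is padded by \<open>\<tau> + u\<close>, so \<open>D n\<close> is the
    future increment and the \<open>D i\<close> with \<open>i < n\<close> describe the past.\<close>
  define D where "D = (\<lambda>i \<omega>. N (if Suc i \<le> n then xs ! Suc i else \<tau> + u) \<omega> - N (if i \<le> n then xs ! i else \<tau> + u) \<omega>)"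
  have set_xs: "set xs = insert 0 (insert \<tau> A)" and sorted: "sorted xs"
    unfolding xs_def using A by (simp_all only: set_sorted_list_of_set sorted_sorted_list_of_set finite_insert)
  have len: "length xs = Suc n"
    using set_xs by (cases xs) (auto simp: n_def)
  have nth_range: "xs ! i \<in> {0..\<tau>}" if "i \<le> n" for i
    using nth_mem[of i xs] that len A \<tau> set_xs by auto
  have xs_0: "xs ! 0 = 0"
  proof -
    obtain i where "i \<le> n" "xs ! i = 0" using set_xs len by (metis in_set_conv_nth insertI1 less_Suc_eq_le)
    then have "xs ! 0 \<le> 0" using sorted_nth_mono[OF sorted, of 0 i] len by simp
    then show ?thesis using nth_range[of 0] by simp
  qed
  have xs_n: "xs ! n = \<tau>"
  proof -
    obtain i where "i \<le> n" "xs ! i = \<tau>"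
      using set_xs len by (metis in_set_conv_nth insertI1 insertI2 less_Suc_eq_le)
    then have "\<tau> \<le> xs ! n" using sorted_nth_mono[OF sorted, of i n] len by simp
    then show ?thesis using nth_range[of n] by simp
  qed
  have mono: "(if i \<le> n then xs ! i else \<tau> + u) \<le> (if Suc i \<le> n then xs ! Suc i else \<tau> + u)" for i
    using sorted_nth_mono[OF sorted, of i "Suc i"] nth_range[of i] u len by auto
  have ind: "indep_vars (\<lambda>_. count_space UNIV) D {..<Suc n}"
  proof -
    have "\<forall>n (\<tau> :: nat \<Rightarrow> real). 0 \<le> \<tau> 0 \<and> (\<forall>i<n. \<tau> i \<le> \<tau> (Suc i)) \<longrightarrow>
        indep_vars (\<lambda>_. count_space UNIV) (\<lambda>i \<omega>. N (\<tau> (Suc i)) \<omega> - N (\<tau> i) \<omega>) {..<n}"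
      using process by (simp add: poisson_process_def)
    from this[rule_format, of "\<lambda>i. if i \<le> n then xs ! i else \<tau> + u" "Suc n"] show ?thesis
      unfolding D_def using mono by (simp only: xs_0 le0 if_True order_refl) simp
  qed
  obtain pos where pos: "\<And>a. a \<in> A \<Longrightarrow> pos a \<le> n \<and> xs ! pos a = a"
  proof -
    have "\<forall>a\<in>A. \<exists>i. i \<le> n \<and> xs ! i = a"
      using set_xs len by (metis in_set_conv_nth insertI2 less_Suc_eq_le)
    from bchoice[OF this] show ?thesis using that by blast
  qed
  define R where "R d = restrict (\<lambda>a. \<Sum>q<pos a. d q :: nat) A" for d
  \<comment> \<open>This holds only almost surely: truncated differences telescope because
    \<open>N\<close> is nondecreasing, and the sum starts from
    \<open>N 0 \<omega> = 0\<close>.\<close>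
  have AE_R: "AE \<omega> in M. restrict (\<lambda>a. N a \<omega>) A = R (restrict (\<lambda>i. D i \<omega>) {..<n})"
    using AE_path
  proof eventually_elim
    case (elim \<omega>)
    have N0: "N 0 \<omega> = 0"
    proof -
      have "\<not> S 1 \<omega> \<le> S 0 \<omega>" using elim by (metis not_one_le_zero)
      then have "\<not> 1 \<le> N 0 \<omega>" using elim by auto
      then show ?thesis by simp
    qed
    have N_mono: "N a \<omega> \<le> N b \<omega>" if "0 \<le> a" "a \<le> b" for a b
    proof -
      have "S (N a \<omega>) \<omega> \<le> a" using elim that by blast
      then show ?thesis using elim that by (meson order_trans)
    qed
    have N_sum: "N (xs ! m) \<omega> = (\<Sum>q<m. D q \<omega>)" if "m \<le> n" for m
      using that
    proof (induction m)
      case 0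
      then show ?case by (simp add: xs_0 N0)
    next
      case (Suc m)
      have "N (xs ! m) \<omega> \<le> N (xs ! Suc m) \<omega>"
        using N_mono nth_range[of m] sorted_nth_mono[OF sorted, of m "Suc m"] Suc.prems len by auto
      then show ?case using Suc by (simp add: D_def)
    qed
    have "N a \<omega> = (\<Sum>q<pos a. restrict (\<lambda>i. D i \<omega>) {..<n} q)" if "a \<in> A" for a
      using N_sum[of "pos a"] pos[OF that] by simp
    then show ?case
      unfolding R_def by (intro restrict_ext)
  qed
  have [measurable]: "D i \<in> measurable M (count_space UNIV)" if "i < Suc n" for i
    using ind that unfolding indep_vars_def by blast
  \<comment> \<open>Over a finite index set the product of countable discrete spaces is discrete, so
    an arbitrary \<open>Q\<close> defines a measurable event.\<close>
  have space_eq: "PiM I (\<lambda>_. count_space UNIV) = count_space (PiE I (\<lambda>_. UNIV :: nat set))" if "finite I" for I :: "'i set"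
    using that by (rule count_space_PiM_finite) simp
  have iv: "indep_var (PiM {..<n} (\<lambda>_. count_space UNIV)) (\<lambda>\<omega>. restrict (\<lambda>i. D i \<omega>) {..<n})
      (PiM {n} (\<lambda>_. count_space UNIV)) (\<lambda>\<omega>. restrict (\<lambda>i. D i \<omega>) {n})"
    by (rule indep_var_restrict[OF ind]) auto
  let ?X = "{d \<in> PiE {..<n} (\<lambda>_. UNIV). Q (R d)}" and ?Y = "{d \<in> PiE {n} (\<lambda>_. UNIV). d n = (0::nat)}"
  have sets: "?X \<in> sets (PiM {..<n} (\<lambda>_. count_space UNIV))" "?Y \<in> sets (PiM {n} (\<lambda>_. count_space UNIV))"
    by (auto simp: space_eq)
  have D_n: "D n \<omega> = N (\<tau> + u) \<omega> - N \<tau> \<omega>" for \<omega>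
    by (simp add: D_def xs_n)
  have N_rv: "(\<lambda>\<omega>. restrict (\<lambda>a. N a \<omega>) A) \<in> measurable M (PiM A (\<lambda>_. count_space UNIV))"
    using A by (intro measurable_restrict count_measurable) auto
  have Q_set: "{\<omega> \<in> space M. Q (restrict (\<lambda>a. N a \<omega>) A)} \<in> events"
  proof -
    have "{\<omega> \<in> space M. Q (restrict (\<lambda>a. N a \<omega>) A)} =
        (\<lambda>\<omega>. restrict (\<lambda>a. N a \<omega>) A) -` {f \<in> PiE A (\<lambda>_. UNIV). Q f} \<inter> space M"
      by auto
    also have "\<dots> \<in> events"
      by (rule measurable_sets[OF N_rv]) (use A in \<open>auto simp: space_eq\<close>)
    finally show ?thesis .
  qed
  have D_set: "{\<omega> \<in> space M. N (\<tau> + u) \<omega> - N \<tau> \<omega> = 0} \<in> events"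
    unfolding D_n[symmetric] by measurable
  have X_set: "(\<lambda>\<omega>. restrict (\<lambda>i. D i \<omega>) {..<n}) -` ?X \<inter> space M \<in> events"
    using indep_var_rv1[OF iv] sets(1) by (rule measurable_sets)
  have Y_set: "(\<lambda>\<omega>. restrict (\<lambda>i. D i \<omega>) {n}) -` ?Y \<inter> space M = {\<omega> \<in> space M. N (\<tau> + u) \<omega> - N \<tau> \<omega> = 0}"
    by (auto simp: D_n)
  have "prob {\<omega> \<in> space M. Q (restrict (\<lambda>a. N a \<omega>) A) \<and> N (\<tau> + u) \<omega> - N \<tau> \<omega> = 0} =
      prob (((\<lambda>\<omega>. restrict (\<lambda>i. D i \<omega>) {..<n}) -` ?X \<inter> space M) \<inter> {\<omega> \<in> space M. N (\<tau> + u) \<omega> - N \<tau> \<omega> = 0})"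
  proof (rule finite_measure_eq_AE)
    have "{\<omega> \<in> space M. Q (restrict (\<lambda>a. N a \<omega>) A) \<and> N (\<tau> + u) \<omega> - N \<tau> \<omega> = 0} =
      {\<omega> \<in> space M. Q (restrict (\<lambda>a. N a \<omega>) A)} \<inter> {\<omega> \<in> space M. N (\<tau> + u) \<omega> - N \<tau> \<omega> = 0}" by auto
    then show "{\<omega> \<in> space M. Q (restrict (\<lambda>a. N a \<omega>) A) \<and> N (\<tau> + u) \<omega> - N \<tau> \<omega> = 0} \<in> events"
      using Q_set D_set by auto
    show "((\<lambda>\<omega>. restrict (\<lambda>i. D i \<omega>) {..<n}) -` ?X \<inter> space M) \<inter> {\<omega> \<in> space M. N (\<tau> + u) \<omega> - N \<tau> \<omega> = 0} \<in> events"
      using X_set D_set by (rule sets.Int)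
    show "AE \<omega> in M. (\<omega> \<in> {\<omega> \<in> space M. Q (restrict (\<lambda>a. N a \<omega>) A) \<and> N (\<tau> + u) \<omega> - N \<tau> \<omega> = 0}) =
        (\<omega> \<in> ((\<lambda>\<omega>. restrict (\<lambda>i. D i \<omega>) {..<n}) -` ?X \<inter> space M) \<inter> {\<omega> \<in> space M. N (\<tau> + u) \<omega> - N \<tau> \<omega> = 0})"
      using AE_R by eventually_elim auto
  qed
  also have "((\<lambda>\<omega>. restrict (\<lambda>i. D i \<omega>) {..<n}) -` ?X \<inter> space M) \<inter> {\<omega> \<in> space M. N (\<tau> + u) \<omega> - N \<tau> \<omega> = 0} =
      (\<lambda>\<omega>. (restrict (\<lambda>i. D i \<omega>) {..<n}, restrict (\<lambda>i. D i \<omega>) {n})) -` (?X \<times> ?Y) \<inter> space M"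
    unfolding Y_set[symmetric] by (rule pair_vimage)
  also have "prob \<dots> = prob ((\<lambda>\<omega>. restrict (\<lambda>i. D i \<omega>) {..<n}) -` ?X \<inter> space M) *
      prob ((\<lambda>\<omega>. restrict (\<lambda>i. D i \<omega>) {n}) -` ?Y \<inter> space M)"
    by (rule indep_varD[OF iv sets])
  also have "prob ((\<lambda>\<omega>. restrict (\<lambda>i. D i \<omega>) {n}) -` ?Y \<inter> space M) = exp (- l * u)"
    unfolding Y_set using \<tau> u by (rule prob_no_event)
  also have "prob ((\<lambda>\<omega>. restrict (\<lambda>i. D i \<omega>) {..<n}) -` ?X \<inter> space M) =
      prob {\<omega> \<in> space M. Q (restrict (\<lambda>a. N a \<omega>) A)}"
  proof (rule finite_measure_eq_AE[OF _ X_set Q_set])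
    show "AE \<omega> in M. (\<omega> \<in> (\<lambda>\<omega>. restrict (\<lambda>i. D i \<omega>) {..<n}) -` ?X \<inter> space M) =
        (\<omega> \<in> {\<omega> \<in> space M. Q (restrict (\<lambda>a. N a \<omega>) A)})"
      using AE_R by eventually_elim auto
  qed
  finally show ?thesis .
qed

text \<open>A strong Markov argument at \<open>S k\<close>. Rounding \<open>S k\<close> up to a grid
  gives a random time with countably many values, and rounding up keeps \<open>S 0, ..., S k\<close>
  in its past. On each cell the time is deterministic, so \<open>prob_past_no_event\<close>
  applies.\<close>

lemma prob_arrivals_gap_nonneg:
  assumes a: "\<And>j. a j \<ge> 0" and u: "u \<ge> 0"
  shows "prob {\<omega> \<in> space M. (\<forall>j\<le>k. S j \<omega> \<le> a j) \<and> u < S (Suc k) \<omega> - S k \<omega>} =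
    prob {\<omega> \<in> space M. \<forall>j\<le>k. S j \<omega> \<le> a j} * exp (- l * u)"
proof -
  define E where "E = {\<omega> \<in> space M. \<forall>j\<le>k. S j \<omega> \<le> a j}"
  define z where "z n i = real i / real (Suc n)" for n i :: nat
  define R where "R n \<omega> = nat \<lceil>S k \<omega> * real (Suc n)\<rceil>" for n \<omega>
  \<comment> \<open>The gap condition is approximated by the absence of events in a window of length
    \<open>u\<close> starting at the rounded time.\<close>
  define F where "F n = {\<omega> \<in> E. N (z n (R n \<omega>) + u) \<omega> - N (z n (R n \<omega>)) \<omega> = 0}" for n
  have E_set [measurable]: "E \<in> events"
    unfolding E_def by measurable
  have R_meas [measurable]: "R n \<in> measurable M (count_space UNIV)" for n
    unfolding R_def by measurable
  have z_nonneg: "z n i \<ge> 0" for n i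
    by (simp add: z_def)
  have N_meas [measurable]: "N (z n i) \<in> measurable M (count_space UNIV)"
    "N (z n i + u) \<in> measurable M (count_space UNIV)" for n i
    using u by (auto intro!: count_measurable z_nonneg add_nonneg_nonneg)
  have cell: "prob {\<omega> \<in> E. R n \<omega> = i \<and> N (z n i + u) \<omega> - N (z n i) \<omega> = 0} =
      prob {\<omega> \<in> E. R n \<omega> = i} * exp (- l * u)" for n i
  proof -
    \<comment> \<open>Counts may be observed only up to \<open>z n i\<close>, hence the minimum.
      Nothing is lost: on the cell, \<open>S j \<omega> \<le> S k \<omega> \<le> z n i\<close> for
      every \<open>j \<le> k\<close>.\<close>
    define A where "A = insert (z n (i - 1)) (insert (z n i) ((\<lambda>j. min (a j) (z n i)) ` {..k}))"
    define Q where "Q f \<longleftrightarrow> (i = 0 \<or> f (z n (i - 1)) < k) \<and> k \<le> f (z n i) \<and>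
      (\<forall>j\<le>k. j \<le> f (min (a j) (z n i)))" for f :: "real \<Rightarrow> nat"
    have "z n (i - 1) \<le> z n i"
      by (simp add: z_def divide_right_mono)
    then have A: "finite A" "A \<subseteq> {0..z n i}"
      using a z_nonneg by (auto simp: A_def)
    have Q_iff: "AE \<omega> in M. Q (restrict (\<lambda>a. N a \<omega>) A) \<longleftrightarrow> \<omega> \<in> E \<and> R n \<omega> = i"
      using AE_path AE_space
    proof eventually_elim
      case (elim \<omega>)
      have mono: "S i \<omega> \<le> S j \<omega>" if "i \<le> j" for i j
        using elim that by simp
      have "S k \<omega> \<ge> 0" using mono[of 0 k] elim by simp
      then have R: "R n \<omega> = i \<longleftrightarrow> (i = 0 \<or> z n (i - 1) < S k \<omega>) \<and> S k \<omega> \<le> z n i"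
        unfolding R_def z_def by (rule nat_ceiling_eq_iff)
      have iff: "j \<le> N t \<omega> \<longleftrightarrow> S j \<omega> \<le> t" if "t \<ge> 0" for t j
        using elim(1)[THEN conjunct2, THEN conjunct2] that by blast
      have "N (z n (i - 1)) \<omega> < k \<longleftrightarrow> z n (i - 1) < S k \<omega>"
        using iff[OF z_nonneg, of k n "i - 1"] by linarith
      moreover have "k \<le> N (z n i) \<omega> \<longleftrightarrow> S k \<omega> \<le> z n i"
        by (rule iff[OF z_nonneg])
      moreover have "j \<le> N (min (a j) (z n i)) \<omega> \<longleftrightarrow> S j \<omega> \<le> a j \<and> S j \<omega> \<le> z n i" for j
        using iff[of "min (a j) (z n i)" j] a z_nonneg by simp
      ultimately have "Q (restrict (\<lambda>a. N a \<omega>) A) \<longleftrightarrow>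
          (i = 0 \<or> z n (i - 1) < S k \<omega>) \<and> S k \<omega> \<le> z n i \<and> (\<forall>j\<le>k. S j \<omega> \<le> a j \<and> S j \<omega> \<le> z n i)"
        by (simp add: Q_def A_def)
      also have "\<dots> \<longleftrightarrow> \<omega> \<in> E \<and> R n \<omega> = i"
        using elim mono by (auto simp: E_def R intro: order_trans)
      finally show ?case .
    qed
    have Q_set: "{\<omega> \<in> space M. Q (restrict (\<lambda>a. N a \<omega>) A)} \<in> events"
    proof -
      have [measurable]: "N (z n (i - 1)) \<in> measurable M (count_space UNIV)"
        "N (min (a j) (z n i)) \<in> measurable M (count_space UNIV)" for j
        using a by (auto intro!: count_measurable z_nonneg)
      show ?thesis
        unfolding Q_def A_def by simp
    qed
    have "prob {\<omega> \<in> E. R n \<omega> = i \<and> N (z n i + u) \<omega> - N (z n i) \<omega> = 0} =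
      prob {\<omega> \<in> space M. Q (restrict (\<lambda>a. N a \<omega>) A) \<and> N (z n i + u) \<omega> - N (z n i) \<omega> = 0}"
    proof (rule finite_measure_eq_AE)
      show "AE \<omega> in M. (\<omega> \<in> {\<omega> \<in> E. R n \<omega> = i \<and> N (z n i + u) \<omega> - N (z n i) \<omega> = 0}) =
          (\<omega> \<in> {\<omega> \<in> space M. Q (restrict (\<lambda>a. N a \<omega>) A) \<and> N (z n i + u) \<omega> - N (z n i) \<omega> = 0})"
        using Q_iff AE_space by eventually_elim auto
      show "{\<omega> \<in> E. R n \<omega> = i \<and> N (z n i + u) \<omega> - N (z n i) \<omega> = 0} \<in> events"
        by measurable
      have "{\<omega> \<in> space M. Q (restrict (\<lambda>a. N a \<omega>) A) \<and> N (z n i + u) \<omega> - N (z n i) \<omega> = 0} =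
          {\<omega> \<in> space M. Q (restrict (\<lambda>a. N a \<omega>) A)} \<inter> {\<omega> \<in> space M. N (z n i + u) \<omega> - N (z n i) \<omega> = 0}"
        by auto
      also have "\<dots> \<in> events"
        using Q_set by (rule sets.Int) measurable
      finally show "{\<omega> \<in> space M. Q (restrict (\<lambda>a. N a \<omega>) A) \<and> N (z n i + u) \<omega> - N (z n i) \<omega> = 0} \<in> events" .
    qed
    also have "\<dots> = prob {\<omega> \<in> space M. Q (restrict (\<lambda>a. N a \<omega>) A)} * exp (- l * u)"
      by (rule prob_past_no_event[OF A z_nonneg u])
    also have "prob {\<omega> \<in> space M. Q (restrict (\<lambda>a. N a \<omega>) A)} = prob {\<omega> \<in> E. R n \<omega> = i}"
    proof (rule finite_measure_eq_AE[OF _ Q_set])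
      show "AE \<omega> in M. (\<omega> \<in> {\<omega> \<in> space M. Q (restrict (\<lambda>a. N a \<omega>) A)}) = (\<omega> \<in> {\<omega> \<in> E. R n \<omega> = i})"
        using Q_iff AE_space by eventually_elim auto
      show "{\<omega> \<in> E. R n \<omega> = i} \<in> events"
        by measurable
    qed
    finally show ?thesis .
  qed
  have F_Union: "F n = (\<Union>i. {\<omega> \<in> E. R n \<omega> = i \<and> N (z n i + u) \<omega> - N (z n i) \<omega> = 0})" for n
    by (auto simp: F_def)
  have F_set [measurable]: "F n \<in> events" for n
    unfolding F_Union by measurable
  \<comment> \<open>Summing over the cells gives the same value for every mesh, so only the
    convergence of \<open>F n\<close> to the gap event remains.\<close>
  have prob_F: "prob (F n) = prob E * exp (- l * u)" for n
  proof -
    have "(\<lambda>i. prob {\<omega> \<in> E. R n \<omega> = i}) sums prob (\<Union>i. {\<omega> \<in> E. R n \<omega> = i})"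
      by (intro finite_measure_UNION image_subsetI) (measurable, auto simp: disjoint_family_on_def)
    also have "(\<Union>i. {\<omega> \<in> E. R n \<omega> = i}) = E"
      by auto
    finally have "(\<lambda>i. prob {\<omega> \<in> E. R n \<omega> = i} * exp (- l * u)) sums (prob E * exp (- l * u))"
      by (rule sums_mult2)
    moreover have "(\<lambda>i. prob {\<omega> \<in> E. R n \<omega> = i} * exp (- l * u)) sums prob (F n)"
      unfolding F_Union cell[symmetric]
      by (intro finite_measure_UNION image_subsetI) (measurable, auto simp: disjoint_family_on_def)
    ultimately show ?thesis by (rule sums_unique2[symmetric])
  qed
  define G where "G = {\<omega> \<in> space M. (\<forall>j\<le>k. S j \<omega> \<le> a j) \<and> u < S (Suc k) \<omega> - S k \<omega>}"
  have G_set [measurable]: "G \<in> events"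
    unfolding G_def by measurable
  have "(\<lambda>n. LINT \<omega>|M. indicator (F n) \<omega> :: real) \<longlonglongrightarrow> (LINT \<omega>|M. indicator G \<omega>)"
  proof (rule integral_dominated_convergence[where w="\<lambda>_. 1"])
    show "AE \<omega> in M. (\<lambda>n. indicator (F n) \<omega> :: real) \<longlonglongrightarrow> indicator G \<omega>"
      using AE_path AE_space
    proof eventually_elim
      case (elim \<omega>)
      have iff: "j \<le> N t \<omega> \<longleftrightarrow> S j \<omega> \<le> t" if "t \<ge> 0" for t j
        using elim(1)[THEN conjunct2, THEN conjunct2] that by blast
      have gap: "S k \<omega> < S (Suc k) \<omega>" using elim by (simp add: not_le[symmetric])
      have Sk: "S k \<omega> \<ge> 0" using elim by (metis le0)
      have z_bounds: "S k \<omega> \<le> z n (R n \<omega>)" "z n (R n \<omega>) < S k \<omega> + 1 / real (Suc n)" for n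
      proof -
        define x where "x = S k \<omega> * real (Suc n)"
        have "x \<ge> 0" using Sk by (simp add: x_def)
        then have "real (R n \<omega>) = of_int \<lceil>x\<rceil>"
          unfolding R_def x_def[symmetric] by simp
        then have "x \<le> real (R n \<omega>)" "real (R n \<omega>) < x + 1"
          by linarith+
        moreover have "S k \<omega> + 1 / real (Suc n) = (x + 1) / real (Suc n)" "S k \<omega> = x / real (Suc n)"
          by (simp_all add: x_def add_divide_distrib del: of_nat_Suc)
        ultimately show "S k \<omega> \<le> z n (R n \<omega>)" "z n (R n \<omega>) < S k \<omega> + 1 / real (Suc n)"
          by (simp_all only: z_def divide_right_mono divide_strict_right_mono of_nat_0_le_iff of_nat_0_less_iff zero_less_Suc)
      qed
      \<comment> \<open>Once the mesh is below \<delta> the indicators agree. If the gap exceeds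
        \<open>u\<close>, the next arrival stays beyond the window despite the rounding. Otherwise
        rounding does not reach the next arrival, which therefore falls inside the window.\<close>
      define \<delta> where "\<delta> = (if u < S (Suc k) \<omega> - S k \<omega> then S (Suc k) \<omega> - S k \<omega> - u else S (Suc k) \<omega> - S k \<omega>)"
      have "\<delta> > 0" using gap by (simp add: \<delta>_def)
      then have "\<forall>\<^sub>F n in sequentially. 1 / real (Suc n) < \<delta>"
        using LIMSEQ_inverse_real_of_nat[THEN order_tendstoD(2), of \<delta>] by (simp add: inverse_eq_divide)
      then have "\<forall>\<^sub>F n in sequentially. indicator (F n) \<omega> = (indicator G \<omega> :: real)"
      proof eventually_elim
        case (elim n)
        let ?\<tau> = "z n (R n \<omega>)"
        have \<tau>: "?\<tau> \<ge> 0" "?\<tau> + u \<ge> 0" using z_nonneg u by (auto intro: add_nonneg_nonneg)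
        have "N (?\<tau> + u) \<omega> - N ?\<tau> \<omega> = 0 \<longleftrightarrow> u < S (Suc k) \<omega> - S k \<omega>"
        proof (cases "u < S (Suc k) \<omega> - S k \<omega>")
          case True
          then have "\<not> Suc k \<le> N (?\<tau> + u) \<omega>"
            using iff[OF \<tau>(2), of "Suc k"] z_bounds[of n] elim by (simp add: \<delta>_def)
          moreover have "k \<le> N ?\<tau> \<omega>"
            using iff[OF \<tau>(1)] z_bounds by blast
          ultimately show ?thesis using True by simp
        next
          case False
          then have "Suc k \<le> N (?\<tau> + u) \<omega>"
            using iff[OF \<tau>(2), of "Suc k"] z_bounds[of n] by linarith
          moreover have "\<not> Suc k \<le> N ?\<tau> \<omega>"
            using False iff[OF \<tau>(1), of "Suc k"] z_bounds[of n] elim by (simp add: \<delta>_def)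
          ultimately show ?thesis using False by simp
        qed
        then show ?case
          using \<open>\<omega> \<in> space M\<close> by (auto simp: F_def E_def G_def indicator_def)
      qed
      then show ?case by (rule tendsto_eventually)
    qed
  qed (auto simp: indicator_def)
  then have "(\<lambda>n. prob (F n)) \<longlonglongrightarrow> prob G"
    by simp
  then have "prob G = prob E * exp (- l * u)"
    unfolding prob_F by (simp add: LIMSEQ_const_iff)
  then show ?thesis by (simp add: G_def E_def)
qed

section \<open>The weighted law of an arrival time\<close>

lemma prob_arrivals_gap:
  assumes "u \<ge> 0"
  shows "prob {\<omega> \<in> space M. (\<forall>j\<le>k. S j \<omega> \<le> a j) \<and> u < S (Suc k) \<omega> - S k \<omega>} =
    prob {\<omega> \<in> space M. \<forall>j\<le>k. S j \<omega> \<le> a j} * exp (- l * u)"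
proof (cases "\<exists>j\<le>k. a j < 0")
  case True
  then obtain i where i: "i \<le> k" "a i < 0" by blast
  have "AE \<omega> in M. \<not> (\<forall>j\<le>k. S j \<omega> \<le> a j)"
    using AE_path
  proof eventually_elim
    case (elim \<omega>)
    then have "S i \<omega> \<ge> 0" by (metis le0)
    with i show ?case by (meson less_le_trans not_le)
  qed
  then have "prob {\<omega> \<in> space M. \<forall>j\<le>k. S j \<omega> \<le> a j} = 0"
    "prob {\<omega> \<in> space M. (\<forall>j\<le>k. S j \<omega> \<le> a j) \<and> u < S (Suc k) \<omega> - S k \<omega>} = 0"
    by (auto intro!: prob_eq_0_AE elim!: eventually_mono)
  then show ?thesis by simp
next
  case False
  \<comment> \<open>Only bounds with index above \<open>k\<close> can still be negative, and the
    event does not involve them.\<close>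
  have *: "(\<forall>j\<le>k. S j \<omega> \<le> a j) \<longleftrightarrow> (\<forall>j\<le>k. S j \<omega> \<le> max 0 (a j))" for \<omega>
    using False by (auto simp: not_less max_def)
  show ?thesis
    unfolding * by (rule prob_arrivals_gap_nonneg) (use assms in auto)
qed

section \<open>Law of the next gap and its independence of the past\<close>

text \<open>Letting the common bound on \<open>S 0, ..., S k\<close> tend to infinity in
  \<open>prob_arrivals_gap\<close> exhausts the space and leaves the marginal tail of the
  gap.\<close>

lemma prob_gap:
  assumes "u \<ge> 0"
  shows "prob {\<omega> \<in> space M. u < S (Suc k) \<omega> - S k \<omega>} = exp (- l * u)"
proof -
  let ?E = "\<lambda>m. {\<omega> \<in> space M. \<forall>j\<le>k. S j \<omega> \<le> real m}"
  let ?T = "{\<omega> \<in> space M. u < S (Suc k) \<omega> - S k \<omega>}"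
  have inc: "incseq ?E"
    by (auto simp: incseq_def intro: order_trans)
  have Un: "(\<Union>m. ?E m) = space M"
  proof -
    have "\<exists>m. \<forall>j\<le>k. S j \<omega> \<le> real m" for \<omega>
    proof -
      obtain m where m: "Max ((\<lambda>j. S j \<omega>) ` {..k}) \<le> real m" using real_arch_simple by blast
      have "S j \<omega> \<le> real m" if "j \<le> k" for j
        using m that by (intro order_trans[OF _ m] Max_ge) auto
      then show ?thesis by blast
    qed
    then show ?thesis by auto
  qed
  have "(\<lambda>m. prob (?E m)) \<longlonglongrightarrow> prob (\<Union>m. ?E m)"
    by (intro finite_Lim_measure_incseq inc) auto
  then have 1: "(\<lambda>m. prob (?E m)) \<longlonglongrightarrow> 1"
    by (simp add: Un prob_space)
  have "(\<lambda>m. prob (?E m \<inter> ?T)) \<longlonglongrightarrow> prob (\<Union>m. ?E m \<inter> ?T)"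
  proof (intro finite_Lim_measure_incseq)
    show "incseq (\<lambda>m. ?E m \<inter> ?T)"
      using inc unfolding incseq_def by blast
  qed auto
  moreover have "(\<Union>m. ?E m \<inter> ?T) = ?T"
    using Un by blast
  moreover have "prob (?E m \<inter> ?T) = prob (?E m) * exp (- l * u)" for m
  proof -
    have "?E m \<inter> ?T = {\<omega> \<in> space M. (\<forall>j\<le>k. S j \<omega> \<le> real m) \<and> u < S (Suc k) \<omega> - S k \<omega>}"
      by auto
    then show ?thesis using prob_arrivals_gap[OF assms, of k "\<lambda>_. real m"] by simp
  qed
  ultimately have "(\<lambda>m. prob (?E m) * exp (- l * u)) \<longlonglongrightarrow> prob ?T"
    by simp
  moreover have "(\<lambda>m. prob (?E m) * exp (- l * u)) \<longlonglongrightarrow> 1 * exp (- l * u)"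
    by (intro tendsto_mult_right 1)
  ultimately show ?thesis
    using LIMSEQ_unique by fastforce
qed

lemma gap_distributed:
  "distributed M lborel (\<lambda>\<omega>. S (Suc k) \<omega> - S k \<omega>) (exponential_density l)"
proof -
  have "prob {\<omega> \<in> space M. S (Suc k) \<omega> - S k \<omega> \<le> u} = 1 - exp (- u * l)" if "u \<ge> 0" for u
  proof -
    have "prob {\<omega> \<in> space M. \<not> (u < S (Suc k) \<omega> - S k \<omega>)} = 1 - prob {\<omega> \<in> space M. u < S (Suc k) \<omega> - S k \<omega>}"
      by (rule prob_neg) measurable
    then show ?thesis
      by (simp add: prob_gap[OF that] not_less mult.commute)
  qed
  then show ?thesis
    using rate_pos by (simp add: exponential_distributed_iff)
qed

text \<open>
  The assumption says that \<open>X\<close> is a measurable functional of \<open>S 0, \<dots>, S k\<close>. The conclusion is the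
  independence of \<open>X\<close> and the gap; \<^const>\<open>prob_space.indep_var\<close> would need both of the same type.
\<close>
lemma distr_arrivals_gap:
  assumes X: "\<And>\<Omega>. space \<Omega> = space M \<Longrightarrow> (\<And>j. j \<le> k \<Longrightarrow> S j \<in> borel_measurable \<Omega>) \<Longrightarrow> X \<in> measurable \<Omega> L"
  shows "distr M L X \<Otimes>\<^sub>M distr M borel (\<lambda>\<omega>. S (Suc k) \<omega> - S k \<omega>) =
    distr M (L \<Otimes>\<^sub>M borel) (\<lambda>\<omega>. (X \<omega>, S (Suc k) \<omega> - S k \<omega>))"
proof -
  let ?T = "\<lambda>\<omega>. S (Suc k) \<omega> - S k \<omega>"
  define GX where "GX = range (\<lambda>a. {\<omega> \<in> space M. \<forall>j\<le>k. S j \<omega> \<le> a j})"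
  define GT where "GT = range (\<lambda>u. {\<omega> \<in> space M. u < ?T \<omega>})"
  have indep: "indep_set (sigma_sets (space M) GX) (sigma_sets (space M) GT)"
  \<comment> \<open>Both generators are closed under intersection, so the product rule on them
    suffices.\<close>
  proof (rule indep_set_sigma_sets)
    show "indep_set GX GT"
    proof (rule indep_setI)
      show "GX \<subseteq> events" "GT \<subseteq> events"
        by (auto simp: GX_def GT_def)
      fix A B assume "A \<in> GX" "B \<in> GT"
      then obtain a u where A: "A = {\<omega> \<in> space M. \<forall>j\<le>k. S j \<omega> \<le> a j}" and B: "B = {\<omega> \<in> space M. u < ?T \<omega>}"
        by (auto simp: GX_def GT_def)
      have AB: "A \<inter> B = {\<omega> \<in> space M. (\<forall>j\<le>k. S j \<omega> \<le> a j) \<and> u < ?T \<omega>}"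
        by (auto simp: A B)
      show "prob (A \<inter> B) = prob A * prob B"
      proof (cases "u \<ge> 0")
        case True
        then show ?thesis
          unfolding AB unfolding A B by (simp only: prob_arrivals_gap prob_gap)
      next
        case False
        \<comment> \<open>Gaps are almost surely positive, so a negative threshold gives an event of
          full probability.\<close>
        have *: "AE \<omega> in M. u < ?T \<omega>"
          using AE_path
        proof eventually_elim
          case (elim \<omega>)
          then have "\<not> S (Suc k) \<omega> \<le> S k \<omega>" by (metis not_less_eq_eq order_refl)
          with False show ?case by simp
        qed
        have "prob B = 1"
          unfolding B using * by (subst prob_Collect_eq_1) auto
        moreover have "prob (A \<inter> B) = prob A"
          by (rule finite_measure_eq_AE) (use * in \<open>auto simp: A B elim!: eventually_mono\<close>)
        ultimately show ?thesis by simp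
      qed
    qed
    show "Int_stable GX"
    proof (rule Int_stableI)
      fix A B assume "A \<in> GX" "B \<in> GX"
      then obtain a b where "A = {\<omega> \<in> space M. \<forall>j\<le>k. S j \<omega> \<le> a j}" "B = {\<omega> \<in> space M. \<forall>j\<le>k. S j \<omega> \<le> b j}"
        by (auto simp: GX_def)
      then have "A \<inter> B = {\<omega> \<in> space M. \<forall>j\<le>k. S j \<omega> \<le> min (a j) (b j)}" by auto
      then show "A \<inter> B \<in> GX" unfolding GX_def by (rule range_eqI[where x="\<lambda>j. min (a j) (b j)"])
    qed
    show "Int_stable GT"
    proof (rule Int_stableI)
      fix A B assume "A \<in> GT" "B \<in> GT"
      then obtain a b where "A = {\<omega> \<in> space M. a < ?T \<omega>}" "B = {\<omega> \<in> space M. b < ?T \<omega>}"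
        by (auto simp: GT_def)
      then have "A \<inter> B = {\<omega> \<in> space M. max a b < ?T \<omega>}" by auto
      then show "A \<inter> B \<in> GT" unfolding GT_def by (rule range_eqI[where x="max a b"])
    qed
  qed
  have GX_Pow: "GX \<subseteq> Pow (space M)" and GT_Pow: "GT \<subseteq> Pow (space M)"
    by (auto simp: GX_def GT_def)
  \<comment> \<open>The assumption ranges over all \<Omega> precisely so that it can be applied to
    the sigma algebra generated by \<open>GX\<close>.\<close>
  have X_sigma: "X \<in> measurable (sigma (space M) GX) L"
  proof (rule X)
    show "space (sigma (space M) GX) = space M"
      using GX_Pow by (rule space_measure_of)
    fix i assume i: "i \<le> k"
    show "S i \<in> borel_measurable (sigma (space M) GX)"
    proof (rule borel_measurable_iff_le[THEN iffD2, rule_format])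
      fix b
      \<comment> \<open>Generators bound all arrivals at once; a single one is isolated by letting
        the other bounds run through the naturals.\<close>
      have "{\<omega> \<in> space M. S i \<omega> \<le> b} = (\<Union>m::nat. {\<omega> \<in> space M. \<forall>j\<le>k. S j \<omega> \<le> (if j = i then b else real m)})"
      proof -
        have "\<exists>m::nat. \<forall>j\<le>k. S j \<omega> \<le> (if j = i then b else real m)" if "S i \<omega> \<le> b" for \<omega>
        proof -
          obtain m where m: "Max ((\<lambda>j. S j \<omega>) ` {..k}) \<le> real m" using real_arch_simple by blast
          have "S j \<omega> \<le> real m" if "j \<le> k" for j
            using that by (intro order_trans[OF _ m] Max_ge) auto
          with that show ?thesis by (intro exI[of _ m]) auto
        qed
        moreover have "S i \<omega> \<le> b" if "\<forall>j\<le>k. S j \<omega> \<le> (if j = i then b else real m)" for \<omega> m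
          using that[rule_format, OF i] by simp
        ultimately have iff: "S i \<omega> \<le> b \<longleftrightarrow> (\<exists>m::nat. \<forall>j\<le>k. S j \<omega> \<le> (if j = i then b else real m))" for \<omega>
          by metis
        show ?thesis unfolding iff by blast
      qed
      also have "\<dots> \<in> sigma_sets (space M) GX"
        by (intro sigma_sets.Union sigma_sets.Basic) (auto simp: GX_def)
      finally show "{w \<in> space (sigma (space M) GX). S i w \<le> b} \<in> sets (sigma (space M) GX)"
        using GX_Pow by (simp add: space_measure_of sets_measure_of)
    qed
  qed
  have T_sigma: "?T \<in> borel_measurable (sigma (space M) GT)"
  proof (rule borel_measurable_iff_greater[THEN iffD2, rule_format])
    fix b
    have "{\<omega> \<in> space M. b < ?T \<omega>} \<in> sigma_sets (space M) GT"
      by (intro sigma_sets.Basic) (auto simp: GT_def)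
    then show "{w \<in> space (sigma (space M) GT). b < ?T w} \<in> sets (sigma (space M) GT)"
      using GT_Pow by (simp add: space_measure_of sets_measure_of)
  qed
  have X_rv [measurable]: "X \<in> measurable M L" by (rule X) auto
  interpret X: prob_space "distr M L X" by (rule prob_space_distr) measurable
  interpret T: prob_space "distr M borel ?T" by (rule prob_space_distr) measurable
  show ?thesis
  proof (rule pair_measure_eqI)
    fix A B assume "A \<in> sets (distr M L X)" "B \<in> sets (distr M borel ?T)"
    then have A [measurable]: "A \<in> sets L" and B [measurable]: "B \<in> sets borel" by auto
    have "X -` A \<inter> space M \<in> sigma_sets (space M) GX"
      using measurable_sets[OF X_sigma A] GX_Pow by (simp add: space_measure_of sets_measure_of)
    moreover have "?T -` B \<inter> space M \<in> sigma_sets (space M) GT"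
      using measurable_sets[OF T_sigma B] GT_Pow by (simp add: space_measure_of sets_measure_of)
    ultimately have "prob ((X -` A \<inter> space M) \<inter> (?T -` B \<inter> space M)) =
        prob (X -` A \<inter> space M) * prob (?T -` B \<inter> space M)"
      by (rule indep_setD[OF indep])
    then show "emeasure (distr M L X) A * emeasure (distr M borel ?T) B =
        emeasure (distr M (L \<Otimes>\<^sub>M borel) (\<lambda>\<omega>. (X \<omega>, ?T \<omega>))) (A \<times> B)"
      by (simp add: emeasure_distr emeasure_eq_measure ennreal_mult[symmetric] pair_vimage)
  qed (simp_all add: X.sigma_finite_measure_axioms T.sigma_finite_measure_axioms cong: sets_pair_measure_cong)
qed

section \<open>Renewal recursion for the weighted law\<close>

definition cosh_prod :: "real \<Rightarrow> nat \<Rightarrow> 'a \<Rightarrow> real" where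
  "cosh_prod c k \<omega> = (\<Prod>j=1..k. cosh (c * (S j \<omega> - S (j - 1) \<omega>)))"

lemma cosh_prod_Suc: "cosh_prod c (Suc k) \<omega> = cosh_prod c k \<omega> * cosh (c * (S (Suc k) \<omega> - S k \<omega>))"
  by (simp add: cosh_prod_def)

lemma cosh_prod_ge_1: "cosh_prod c k \<omega> \<ge> 1"
  unfolding cosh_prod_def by (intro prod_ge_1) (simp add: cosh_real_ge_1)

lemma cosh_prod_measurable [measurable]: "cosh_prod c k \<in> borel_measurable M"
  unfolding cosh_prod_def[abs_def] by measurable

text \<open>The new \<open>cosh\<close> factor depends only on the last gap, which is exponential
  and independent of the pair of the earlier product and \<open>S k\<close>. Tonelli then integrates
  over the past for each fixed gap \<open>x\<close>.\<close>

lemma nn_integral_cosh_prod_Suc: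
  assumes [measurable]: "\<psi> \<in> borel_measurable borel"
  shows "(\<integral>\<^sup>+\<omega>. ennreal (cosh_prod c (Suc k) \<omega>) * \<psi> (S (Suc k) \<omega>) \<partial>M) =
    (\<integral>\<^sup>+x. ennreal (exponential_density l x * cosh (c * x)) *
      (\<integral>\<^sup>+\<omega>. ennreal (cosh_prod c k \<omega>) * \<psi> (S k \<omega> + x) \<partial>M) \<partial>lborel)"
proof -
  let ?T = "\<lambda>\<omega>. S (Suc k) \<omega> - S k \<omega>"
  let ?X = "\<lambda>\<omega>. (cosh_prod c k \<omega>, S k \<omega>)"
  define \<Phi> where "\<Phi> z = ennreal (fst (fst z)) * ennreal (cosh (c * snd z)) * \<psi> (snd (fst z) + snd z)"
    for z :: "(real \<times> real) \<times> real"
  have \<Phi> [measurable]: "\<Phi> \<in> borel_measurable ((borel \<Otimes>\<^sub>M borel) \<Otimes>\<^sub>M borel)"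
    unfolding \<Phi>_def[abs_def] by measurable
  have joint: "distr M (borel \<Otimes>\<^sub>M borel) ?X \<Otimes>\<^sub>M distr M borel ?T =
      distr M ((borel \<Otimes>\<^sub>M borel) \<Otimes>\<^sub>M borel) (\<lambda>\<omega>. (?X \<omega>, ?T \<omega>))"
  proof (rule distr_arrivals_gap)
    fix \<Omega> :: "'a measure"
    assume [measurable (raw)]: "\<And>j. j \<le> k \<Longrightarrow> S j \<in> borel_measurable \<Omega>"
    have "(\<lambda>\<omega>. cosh (c * (S j \<omega> - S (j - 1) \<omega>))) \<in> borel_measurable \<Omega>" if "j \<in> {1..k}" for j
      using that by (intro measurable_compose[OF _ borel_measurable_cosh_real]) auto
    then have "cosh_prod c k \<in> borel_measurable \<Omega>"
      unfolding cosh_prod_def[abs_def] by (rule borel_measurable_prod)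
    then show "?X \<in> measurable \<Omega> (borel \<Otimes>\<^sub>M borel)"
      by simp
  qed
  interpret X: prob_space "distr M (borel \<Otimes>\<^sub>M borel) ?X"
    by (rule prob_space_distr) measurable
  interpret T: prob_space "distr M borel ?T"
    by (rule prob_space_distr) measurable
  interpret XT: pair_sigma_finite "distr M (borel \<Otimes>\<^sub>M borel) ?X" "distr M borel ?T" ..
  have T_distr: "distr M borel ?T = density lborel (\<lambda>x. ennreal (exponential_density l x))"
    using distributed_distr_eq_density[OF gap_distributed] by (simp cong: distr_cong)
  have "(\<integral>\<^sup>+\<omega>. ennreal (cosh_prod c (Suc k) \<omega>) * \<psi> (S (Suc k) \<omega>) \<partial>M) = (\<integral>\<^sup>+\<omega>. \<Phi> (?X \<omega>, ?T \<omega>) \<partial>M)"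
    using order_trans[OF zero_le_one cosh_prod_ge_1]
    by (simp add: \<Phi>_def cosh_prod_Suc ennreal_mult cosh_real_nonneg)
  also have "\<dots> = (\<integral>\<^sup>+z. \<Phi> z \<partial>distr M ((borel \<Otimes>\<^sub>M borel) \<Otimes>\<^sub>M borel) (\<lambda>\<omega>. (?X \<omega>, ?T \<omega>)))"
    by (subst nn_integral_distr) auto
  also have "\<dots> = (\<integral>\<^sup>+z. \<Phi> z \<partial>(distr M (borel \<Otimes>\<^sub>M borel) ?X \<Otimes>\<^sub>M distr M borel ?T))"
    by (simp only: joint)
  also have "\<dots> = (\<integral>\<^sup>+x. \<integral>\<^sup>+p. \<Phi> (p, x) \<partial>distr M (borel \<Otimes>\<^sub>M borel) ?X \<partial>distr M borel ?T)"
  proof (subst XT.nn_integral_snd)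
    show "\<Phi> \<in> borel_measurable (distr M (borel \<Otimes>\<^sub>M borel) ?X \<Otimes>\<^sub>M distr M borel ?T)"
      using \<Phi> unfolding measurable_def joint by simp
  qed simp
  also have "\<dots> = (\<integral>\<^sup>+x. \<integral>\<^sup>+\<omega>. \<Phi> (?X \<omega>, x) \<partial>M \<partial>distr M borel ?T)"
    by (intro nn_integral_cong nn_integral_distr) auto
  also have "\<dots> = (\<integral>\<^sup>+x. ennreal (exponential_density l x) * (\<integral>\<^sup>+\<omega>. \<Phi> (?X \<omega>, x) \<partial>M) \<partial>lborel)"
    unfolding T_distr by (subst nn_integral_density) auto
  also have "\<dots> = (\<integral>\<^sup>+x. ennreal (exponential_density l x * cosh (c * x)) *
      (\<integral>\<^sup>+\<omega>. ennreal (cosh_prod c k \<omega>) * \<psi> (S k \<omega> + x) \<partial>M) \<partial>lborel)"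
  proof (intro nn_integral_cong)
    fix x
    have "(\<integral>\<^sup>+\<omega>. \<Phi> (?X \<omega>, x) \<partial>M) =
        (\<integral>\<^sup>+\<omega>. ennreal (cosh (c * x)) * (ennreal (cosh_prod c k \<omega>) * \<psi> (S k \<omega> + x)) \<partial>M)"
      by (simp add: \<Phi>_def mult_ac)
    also have "\<dots> = ennreal (cosh (c * x)) * (\<integral>\<^sup>+\<omega>. ennreal (cosh_prod c k \<omega>) * \<psi> (S k \<omega> + x) \<partial>M)"
      by (rule nn_integral_cmult) measurable
    finally show "ennreal (exponential_density l x) * (\<integral>\<^sup>+\<omega>. \<Phi> (?X \<omega>, x) \<partial>M) =
        ennreal (exponential_density l x * cosh (c * x)) *
          (\<integral>\<^sup>+\<omega>. ennreal (cosh_prod c k \<omega>) * \<psi> (S k \<omega> + x) \<partial>M)"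
      using rate_pos by (simp add: ennreal_mult'' cosh_real_nonneg mult.assoc)
  qed
  finally show ?thesis .
qed

text \<open>Expanding \<open>cosh\<close> into two exponentials yields the factor
  \<open>l / 2\<close>, whose powers supply both \<open>l ^ k\<close> and \<open>1 / 2 ^ k\<close>
  in the final formula.\<close>

lemma exponential_cosh_eq_gam:
  "ennreal (exponential_density l x * cosh (c * x)) = ennreal (l / 2) * (gam 0 (c - l) x + gam 0 (- c - l) x)"
proof (cases "x < 0")
  case True
  then show ?thesis by (simp add: exponential_density_def erlang_density_def gam_def)
next
  case False
  have "l * exp (- l * x) * cosh (c * x) = l / 2 * (exp ((c - l) * x) + exp ((- c - l) * x))"
    by (simp add: cosh_def exp_add[symmetric] field_simps)
  then show ?thesis
    using False rate_pos by (simp add: erlang_density_def gam_def ennreal_mult[symmetric] ennreal_plus[symmetric] del: ennreal_plus)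
qed

text \<open>Induction starts at one because \<open>S 0\<close> is a point mass without density. The
  test function is generalised since the step uses the hypothesis for its translate by the last
  gap.\<close>

lemma nn_integral_cosh_prod:
  assumes "k \<ge> 1" and "\<psi> \<in> borel_measurable borel"
  shows "(\<integral>\<^sup>+\<omega>. ennreal (cosh_prod c k \<omega>) * \<psi> (S k \<omega>) \<partial>M) =
    (\<integral>\<^sup>+s. \<psi> s * (ennreal ((l / 2) ^ k) * rate_mix (c - l) (- c - l) k s) \<partial>lborel)"
  using assms
proof (induction k arbitrary: \<psi> rule: dec_induct)
  case base
  note [measurable] = base
  have "(\<integral>\<^sup>+\<omega>. ennreal (cosh_prod c (Suc 0) \<omega>) * \<psi> (S (Suc 0) \<omega>) \<partial>M) =
      (\<integral>\<^sup>+x. ennreal (exponential_density l x * cosh (c * x)) *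
        (\<integral>\<^sup>+\<omega>. ennreal (cosh_prod c 0 \<omega>) * \<psi> (S 0 \<omega> + x) \<partial>M) \<partial>lborel)"
    by (rule nn_integral_cosh_prod_Suc) fact
  also have "\<dots> = (\<integral>\<^sup>+x. ennreal (exponential_density l x * cosh (c * x)) * \<psi> x \<partial>lborel)"
  proof (intro nn_integral_cong arg_cong2[where f="(*)"] refl)
    fix x
    have "(\<integral>\<^sup>+\<omega>. ennreal (cosh_prod c 0 \<omega>) * \<psi> (S 0 \<omega> + x) \<partial>M) = (\<integral>\<^sup>+\<omega>. \<psi> x \<partial>M)"
      by (rule nn_integral_cong_AE) (use AE_path in \<open>auto simp: cosh_prod_def elim!: eventually_mono\<close>)
    then show "(\<integral>\<^sup>+\<omega>. ennreal (cosh_prod c 0 \<omega>) * \<psi> (S 0 \<omega> + x) \<partial>M) = \<psi> x"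
      by (simp add: emeasure_space_1)
  qed
  also have "\<dots> = (\<integral>\<^sup>+s. \<psi> s * (ennreal ((l / 2) ^ 1) * rate_mix (c - l) (- c - l) 1 s) \<partial>lborel)"
    by (simp only: exponential_cosh_eq_gam rate_mix_1 power_one_right mult.commute[of _ "\<psi> _"])
  finally show ?case by simp
next
  case (step k)
  note [measurable] = step.prems
  let ?q = "rate_mix (c - l) (- c - l)"
  let ?f = "\<lambda>x. gam 0 (c - l) x + gam 0 (- c - l) x"
  have "(\<integral>\<^sup>+\<omega>. ennreal (cosh_prod c (Suc k) \<omega>) * \<psi> (S (Suc k) \<omega>) \<partial>M) =
      (\<integral>\<^sup>+x. ennreal (exponential_density l x * cosh (c * x)) *
        (\<integral>\<^sup>+\<omega>. ennreal (cosh_prod c k \<omega>) * \<psi> (S k \<omega> + x) \<partial>M) \<partial>lborel)"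
    by (rule nn_integral_cosh_prod_Suc) fact
  also have "\<dots> = (\<integral>\<^sup>+x. \<integral>\<^sup>+s. ennreal (l / 2) * ?f x * (\<psi> s * (ennreal ((l / 2) ^ k) * ?q k (s - x))) \<partial>lborel \<partial>lborel)"
  proof (intro nn_integral_cong)
    fix x
    have "(\<integral>\<^sup>+\<omega>. ennreal (cosh_prod c k \<omega>) * \<psi> (S k \<omega> + x) \<partial>M) =
        (\<integral>\<^sup>+s. \<psi> (s + x) * (ennreal ((l / 2) ^ k) * ?q k s) \<partial>lborel)"
      by (rule step.IH[of "\<lambda>s. \<psi> (s + x)"]) measurable
    \<comment> \<open>The shift makes \<open>s\<close> the time of the new arrival, so that \<psi>
      no longer depends on \<open>x\<close>.\<close>
    also have "\<dots> = ennreal \<bar>1\<bar> * (\<integral>\<^sup>+s. \<psi> ((- x + 1 * s) + x) * (ennreal ((l / 2) ^ k) * ?q k (- x + 1 * s)) \<partial>lborel)"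
      by (rule nn_integral_real_affine) auto
    also have "\<dots> = (\<integral>\<^sup>+s. \<psi> s * (ennreal ((l / 2) ^ k) * ?q k (s - x)) \<partial>lborel)"
      by simp
    finally show "ennreal (exponential_density l x * cosh (c * x)) *
        (\<integral>\<^sup>+\<omega>. ennreal (cosh_prod c k \<omega>) * \<psi> (S k \<omega> + x) \<partial>M) =
        (\<integral>\<^sup>+s. ennreal (l / 2) * ?f x * (\<psi> s * (ennreal ((l / 2) ^ k) * ?q k (s - x))) \<partial>lborel)"
      by (simp only: exponential_cosh_eq_gam) (subst nn_integral_cmult, auto)
  qed
  \<comment> \<open>After the exchange the inner integral over \<open>x\<close> is a convolution
    with \<open>rate_mix\<close>.\<close>
  also have "\<dots> = (\<integral>\<^sup>+s. \<integral>\<^sup>+x. ennreal (l / 2) * ?f x * (\<psi> s * (ennreal ((l / 2) ^ k) * ?q k (s - x))) \<partial>lborel \<partial>lborel)"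
    by (rule lborel_pair.Fubini') measurable
  also have "\<dots> = (\<integral>\<^sup>+s. \<psi> s * (ennreal ((l / 2) ^ Suc k) * ?q (Suc k) s) \<partial>lborel)"
  proof (intro nn_integral_cong)
    fix s
    have "ennreal ((l / 2) ^ Suc k) = ennreal (l / 2) * ennreal ((l / 2) ^ k)"
      using rate_pos by (subst ennreal_mult[symmetric]) auto
    then have "ennreal (l / 2) * ?f x * (\<psi> s * (ennreal ((l / 2) ^ k) * ?q k (s - x))) =
        \<psi> s * ennreal ((l / 2) ^ Suc k) * (?f x * ?q k (s - x))" for x
      by (simp only: mult_ac)
    then have "(\<integral>\<^sup>+x. ennreal (l / 2) * ?f x * (\<psi> s * (ennreal ((l / 2) ^ k) * ?q k (s - x))) \<partial>lborel) =
        (\<integral>\<^sup>+x. \<psi> s * ennreal ((l / 2) ^ Suc k) * (?f x * ?q k (s - x)) \<partial>lborel)"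
      by (simp only:)
    also have "\<dots> = \<psi> s * ennreal ((l / 2) ^ Suc k) * conv ?f (?q k) s"
      unfolding conv_def by (rule nn_integral_cmult) measurable
    finally show "(\<integral>\<^sup>+x. ennreal (l / 2) * ?f x * (\<psi> s * (ennreal ((l / 2) ^ k) * ?q k (s - x))) \<partial>lborel) =
        \<psi> s * (ennreal ((l / 2) ^ Suc k) * ?q (Suc k) s)"
      using step.hyps by (simp only: conv_rate_mix mult.assoc)
  qed
  finally show ?case .
qed

end

section \<open>From weighted laws to the expectation\<close>

lemma set_integral_eq_rate_mix:
  assumes "k \<ge> 1" "l > 0"
  shows "enn2real (\<integral>\<^sup>+s. ennreal (cosh (c * (t - s)) * indicator {0..t} s) *
      (ennreal ((l / 2) ^ k) * rate_mix (c - l) (- c - l) k s) \<partial>lborel) =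
    1 / 2 ^ k * (LBINT s:{0..t}. cosh (c * (t - s)) * h k c s * g s k l)"
proof -
  let ?F = "\<lambda>s. 1 / 2 ^ k * (indicator {0..t} s *\<^sub>R (cosh (c * (t - s)) * h k c s * g s k l))"
  have F_nonneg: "?F s \<ge> 0" for s
    using assms by (auto simp: g_def h_nonneg cosh_real_nonneg indicator_def
        intro!: mult_nonneg_nonneg divide_nonneg_nonneg Gamma_real_pos[THEN less_imp_le])
  \<comment> \<open>The closed form of \<open>rate_mix\<close> is available only for positive
    \<open>s\<close>; the point zero is null.\<close>
  have "AE s in lborel. s \<noteq> (0::real)"
    by (rule AE_lborel_singleton)
  then have "(\<integral>\<^sup>+s. ennreal (cosh (c * (t - s)) * indicator {0..t} s) *
      (ennreal ((l / 2) ^ k) * rate_mix (c - l) (- c - l) k s) \<partial>lborel) = (\<integral>\<^sup>+s. ennreal (?F s) \<partial>lborel)"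
  proof (intro nn_integral_cong_AE, eventually_elim)
    case (elim s)
    show ?case
    proof (cases "s \<in> {0..t}")
      case True
      with elim have s: "s > 0" by simp
      have "Gamma (real k) = fact (k - 1)"
        using Gamma_fact[of "k - 1", where 'a=real] assms by (simp add: of_nat_diff)
      then have F: "?F s = cosh (c * (t - s)) * ((l / 2) ^ k * (h k c s * exp (- l * s) * s ^ (k - 1) / fact (k - 1)))"
        using True by (simp add: g_def power_divide)
      have "(l / 2) ^ k \<ge> 0" "h k c s * exp (- l * s) * s ^ (k - 1) / fact (k - 1) \<ge> 0"
        using assms s by (simp_all add: h_nonneg)
      then have "ennreal (?F s) = ennreal (cosh (c * (t - s))) *
          (ennreal ((l / 2) ^ k) * rate_mix (c - l) (- c - l) k s)"
        unfolding F rate_mix_eq[OF assms(1) s] by (simp only: ennreal_mult mult_nonneg_nonneg cosh_real_nonneg)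
      then show ?thesis
        using True by simp
    next
      case False
      then show ?thesis by simp
    qed
  qed
  moreover have "(LINT s|lborel. ?F s) = enn2real (\<integral>\<^sup>+s. ennreal (?F s) \<partial>lborel)"
  proof (rule integral_eq_nn_integral)
    have [measurable]: "(\<lambda>s. cosh (c * (t - s))) \<in> borel_measurable lborel"
      by (intro measurable_compose[OF _ borel_measurable_cosh_real]) simp
    show "?F \<in> borel_measurable lborel"
      unfolding g_def by measurable
  qed (use F_nonneg in auto)
  ultimately show ?thesis
    unfolding set_lebesgue_integral_def by simp
qed

theorem mainTheorem4:
  fixes M :: "'a measure" and N :: "real \<Rightarrow> 'a \<Rightarrow> nat" and S :: "nat \<Rightarrow> 'a \<Rightarrow> real"
    and c l t :: real and k :: nat
  assumes "c > 0" and "l > 0" and "k \<ge> 1" and "t > 0"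
    and "poisson_process M l N S"
  shows "integrable M (\<lambda>\<omega>. cosh (hyp_distance c S k t \<omega>) * indicator {\<omega> \<in> space M. N t \<omega> \<ge> k} \<omega>) \<and>
    (LINT \<omega>|M. cosh (hyp_distance c S k t \<omega>) * indicator {\<omega> \<in> space M. N t \<omega> \<ge> k} \<omega>)
      = 1 / 2 ^ k * (LBINT s:{0..t}. cosh (c * (t - s)) * h k c s * g s k l)"
proof -
  interpret poisson_arrivals M l N S
    using assms by unfold_locales
  let ?Z = "\<lambda>\<omega>. cosh (hyp_distance c S k t \<omega>) * indicator {\<omega> \<in> space M. N t \<omega> \<ge> k} \<omega>"
  \<comment> \<open>The event \<open>N t \<omega> \<ge> k\<close> becomes
    \<open>S k \<omega> \<in> {0..t}\<close> almost surely, so the random variable is the weight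
    times a function of \<open>S k\<close> alone.\<close>
  let ?\<psi> = "\<lambda>s. cosh (c * (t - s)) * indicator {0..t} s :: real"
  have [measurable]: "N t \<in> measurable M (count_space UNIV)"
    using assms by (intro count_measurable) simp
  have \<psi> [measurable]: "?\<psi> \<in> borel_measurable borel"
    by measurable
  have cosh_hyp: "cosh (hyp_distance c S k t \<omega>) = cosh (c * (t - S k \<omega>)) * cosh_prod c k \<omega>" for \<omega>
  proof -
    \<comment> \<open>The argument being at least one is what allows \<open>cosh\<close> to cancel
      \<open>arcosh\<close>.\<close>
    have "1 * 1 \<le> cosh (c * (t - S k \<omega>)) * cosh_prod c k \<omega>"
      by (intro mult_mono cosh_real_ge_1 cosh_prod_ge_1) (auto simp: cosh_real_nonneg)
    then show ?thesis
      by (simp add: hyp_distance_def cosh_prod_def cosh_arcosh_real)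
  qed
  have Z_meas [measurable]: "?Z \<in> borel_measurable M"
    unfolding cosh_hyp by measurable
  have Z_eq: "AE \<omega> in M. ?Z \<omega> = cosh_prod c k \<omega> * ?\<psi> (S k \<omega>)"
    using AE_path AE_space
  proof eventually_elim
    case (elim \<omega>)
    have "S k \<omega> \<ge> 0" using elim by (metis le0)
    moreover have "k \<le> N t \<omega> \<longleftrightarrow> S k \<omega> \<le> t"
      using elim(1)[THEN conjunct2, THEN conjunct2] assms by simp
    ultimately show ?case
      using elim by (simp add: cosh_hyp indicator_def)
  qed
  \<comment> \<open>By \<open>cosh x \<le> exp x\<close> for nonnegative \<open>x\<close>, the
    exponents of the product telescope to \<open>c * S k \<omega>\<close>, which is at most
    \<open>c * t\<close> on the event. Integrability needs this bound, since \<open>enn2real\<close>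
    would hide an infinite value.\<close>
  have Z_bound: "AE \<omega> in M. norm (?Z \<omega>) \<le> exp (c * t) * exp (c * t)"
    using AE_path Z_eq
  proof eventually_elim
    case (elim \<omega>)
    have prod_bound: "cosh_prod c m \<omega> \<le> exp (c * S m \<omega>)" for m
    proof (induction m)
      case 0
      then show ?case using elim by (simp add: cosh_prod_def)
    next
      case (Suc m)
      have "S m \<omega> \<le> S (Suc m) \<omega>" using elim by (metis le_SucI order_refl)
      then have "cosh (c * (S (Suc m) \<omega> - S m \<omega>)) \<le> exp (c * (S (Suc m) \<omega> - S m \<omega>))"
        using assms by (intro cosh_le_exp) simp
      then have "cosh_prod c (Suc m) \<omega> \<le> exp (c * S m \<omega>) * exp (c * (S (Suc m) \<omega> - S m \<omega>))"
        unfolding cosh_prod_Suc using Suc by (intro mult_mono) (auto simp: cosh_real_nonneg)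
      also have "\<dots> = exp (c * S (Suc m) \<omega>)"
        by (simp add: exp_add[symmetric] algebra_simps)
      finally show ?case .
    qed
    have P0: "cosh_prod c k \<omega> \<ge> 0"
      using cosh_prod_ge_1[of c k \<omega>] by linarith
    show ?case
    proof (cases "S k \<omega> \<in> {0..t}")
      case True
      have "cosh (c * (t - S k \<omega>)) \<le> exp (c * (t - S k \<omega>))"
        using assms True by (intro cosh_le_exp) simp
      also have "\<dots> \<le> exp (c * t)" using True assms by simp
      finally have "cosh (c * (t - S k \<omega>)) \<le> exp (c * t)" .
      moreover have "cosh_prod c k \<omega> \<le> exp (c * t)"
        using prod_bound[of k] True assms by (auto intro: order_trans)
      ultimately have "cosh_prod c k \<omega> * cosh (c * (t - S k \<omega>)) \<le> exp (c * t) * exp (c * t)"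
        by (intro mult_mono) (auto simp: cosh_real_nonneg)
      then show ?thesis
        using elim(2) True P0 by (simp add: abs_mult cosh_real_nonneg)
    next
      case False
      then show ?thesis using elim(2) by simp
    qed
  qed
  have "integrable M ?Z"
    using Z_bound by (intro integrable_const_bound) auto
  moreover have "(LINT \<omega>|M. ?Z \<omega>) = enn2real (\<integral>\<^sup>+\<omega>. ennreal (?Z \<omega>) \<partial>M)"
    by (rule integral_eq_nn_integral) (auto simp: cosh_real_nonneg)
  moreover have "(\<integral>\<^sup>+\<omega>. ennreal (?Z \<omega>) \<partial>M) = (\<integral>\<^sup>+\<omega>. ennreal (cosh_prod c k \<omega>) * ennreal (?\<psi> (S k \<omega>)) \<partial>M)"
  proof (rule nn_integral_cong_AE)
    show "AE \<omega> in M. ennreal (?Z \<omega>) = ennreal (cosh_prod c k \<omega>) * ennreal (?\<psi> (S k \<omega>))"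
      using Z_eq
    proof eventually_elim
      case (elim \<omega>)
      have "cosh_prod c k \<omega> \<ge> 0"
        using cosh_prod_ge_1[of c k \<omega>] by linarith
      then show ?case
        unfolding elim by (rule ennreal_mult) (simp add: cosh_real_nonneg)
    qed
  qed
  moreover have "\<dots> = (\<integral>\<^sup>+s. ennreal (?\<psi> s) * (ennreal ((l / 2) ^ k) * rate_mix (c - l) (- c - l) k s) \<partial>lborel)"
    using assms by (intro nn_integral_cosh_prod[where \<psi>="\<lambda>s. ennreal (?\<psi> s)"]) auto
  ultimately show ?thesis
    using set_integral_eq_rate_mix[OF assms(3,2), of c t] by simp
qed

end
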